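(* Assume $\mathfrak{p}\nmid 2$ and $L$ has Gram matrix $G=\operatorname{diag}(1,\alpha)$ with $\alpha\in\mathcal{O}$ (notation in the context). Then $$\beta_{\mathfrak{p}}^{+}(X;X)=\begin{cases}1-\eta(-\alpha)N(\mathfrak{p})^{-1},&\text{if }\mathfrak{t}_m=0,\\ N(\mathfrak{p})^{-\mathfrak{t}_m+\min(\mathfrak{t}_m,\mathfrak{t}_\nu,\mathfrak{t}_s)},&\text{if }\mathfrak{t}_m\geq1.\end{cases}$$
   Context: $K$ is a finite extension of $\mathbb{Q}_p$ with ring of integers $\mathcal{O}$, maximal ideal $\mathfrak{p}$, uniformizer $\pi$, normalized valuation $\operatorname{ord}_\mathfrak{p}$ ($\operatorname{ord}_\mathfrak{p}(0)=\infty$), $e=\operatorname{ord}_\mathfrak{p}(2)$, $N(\mathfrak{p})=|\mathcal{O}/\mathfrak{p}|$. $L$ is a lattice in a $2$-dimensional quadratic space over $K$ with basis $\{e_1,e_2\}$ and Gram matrix $G=\operatorname{diag}(1,\alpha)$. $X=L+\nu$ with $\nu=(s_1e_1+s_2e_2)/\pi^{\mathfrak{t}_m}$, $\mathfrak{t}_m\in\mathbb{Z}$, $s_1,s_2\in\mathcal{O}$, at least one a unit; $\mathfrak{t}_\nu=\operatorname{ord}_\mathfrak{p}(s_1^2+\alpha s_2^2)$, $\mathfrak{t}_s=\operatorname{ord}_\mathfrak{p}(s_1)$. Put $\mathfrak{t}_L=e$. For $t\geq\max(\mathfrak{t}_m,\mathfrak{t}_L+1)$, $O^{+}(X,\mathfrak{p}^t)=\{M\in\mathrm{GL}_2(\mathcal{O}/\mathfrak{p}^t):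 M^TGM\equiv G,\ \det M\equiv1\pmod{\mathfrak{p}^{t+\mathfrak{t}_L}},\ M\binom{s_1}{s_2}\equiv\binom{s_1}{s_2}\pmod{\mathfrak{p}^{\mathfrak{t}_m}}\}$, and $\beta_{\mathfrak{p}}^{+}(X;X)=\lim_{t\to\infty}|O^{+}(X,\mathfrak{p}^t)|/N(\mathfrak{p})^t$. For $x\in\mathcal{O}$: $\eta(x)=1$ if $x$ is a unit congruent to a square mod $\mathfrak{p}$, $-1$ if $x$ is a unit not congruent to a square mod $\mathfrak{p}$, $-N(\mathfrak{p})$ if $x\in\mathfrak{p}$. *)

theory Defs
  imports "HOL-Analysis.Analysis"
begin

section \<open>Finite extensions of the p-adic numbers\<close>

text \<open>A discrete valuation is given by its integer values \<open>v x\<close> at \<open>x \<noteq> 0\<close>; the value \<open>v 0\<close> is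
  junk, and \<open>ordp v\<close> is the valuation with its usual value \<open>\<infinity>\<close> at \<open>0\<close>.\<close>

definition ordp :: "('k::field \<Rightarrow> int) \<Rightarrow> 'k \<Rightarrow> ereal" where
  "ordp v x = (if x = 0 then \<infinity> else ereal (real_of_int (v x)))"

text \<open>The fractional ideal \<open>\<pp>\<^sup>n\<close>, for any integer \<open>n\<close>.\<close>

definition ppow :: "('k::field \<Rightarrow> int) \<Rightarrow> int \<Rightarrow> 'k set" where
  "ppow v n = {x. ereal (real_of_int n) \<le> ordp v x}"

definition integers_of :: "('k::field \<Rightarrow> int) \<Rightarrow> 'k set" where
  "integers_of v = {x. 0 \<le> ordp v x}"

definition max_ideal :: "('k::field \<Rightarrow> int) \<Rightarrow> 'k set" where
  "max_ideal v = {x. 0 < ordp v x}"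

definition is_v_limit :: "('k::field \<Rightarrow> int) \<Rightarrow> (nat \<Rightarrow> 'k) \<Rightarrow> 'k \<Rightarrow> bool" where
  "is_v_limit v u l \<longleftrightarrow> (\<forall>n. \<exists>i0. \<forall>i\<ge>i0. u i - l \<in> ppow v n)"

definition is_v_Cauchy :: "('k::field \<Rightarrow> int) \<Rightarrow> (nat \<Rightarrow> 'k) \<Rightarrow> bool" where
  "is_v_Cauchy v u \<longleftrightarrow> (\<forall>n. \<exists>i0. \<forall>i\<ge>i0. \<forall>j\<ge>i0. u i - u j \<in> ppow v n)"

text \<open>The subfield \<open>Qp\<close> is the completion of \<open>\<rat>\<close> for the p-adic topology: it is complete and
  contains \<open>\<rat>\<close> as a dense subset, and \<open>v p > 0\<close> makes the restriction of \<open>v\<close> to \<open>\<rat>\<close> a positive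
  multiple (by the ramification index) of the p-adic valuation. The field \<open>K\<close> is the whole type
  \<open>'k\<close>.\<close>

locale padic_extension =
  fixes p :: nat and Qp :: "'k::field_char_0 set" and v :: "'k \<Rightarrow> int"
  assumes prime_p: "prime p"
    and v_mult: "\<And>x y. x \<noteq> 0 \<Longrightarrow> y \<noteq> 0 \<Longrightarrow> v (x * y) = v x + v y"
    and v_add: "\<And>x y. x \<noteq> 0 \<Longrightarrow> y \<noteq> 0 \<Longrightarrow> x + y \<noteq> 0 \<Longrightarrow> min (v x) (v y) \<le> v (x + y)"
    and v_normalized: "\<exists>x. x \<noteq> 0 \<and> v x = 1"
    and v_p: "0 < v (of_nat p)"
    and Qp_diff: "\<And>x y. x \<in> Qp \<Longrightarrow> y \<in> Qp \<Longrightarrow> x - y \<in> Qp"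
    and Qp_mult: "\<And>x y. x \<in> Qp \<Longrightarrow> y \<in> Qp \<Longrightarrow> x * y \<in> Qp"
    and Qp_inverse: "\<And>x. x \<in> Qp \<Longrightarrow> inverse x \<in> Qp"
    and Rats_Qp: "\<rat> \<subseteq> Qp"
    and Rats_dense: "\<And>x n. x \<in> Qp \<Longrightarrow> \<exists>r\<in>\<rat>. x - r \<in> ppow v n"
    and Qp_complete:
      "\<And>u. range u \<subseteq> Qp \<Longrightarrow> is_v_Cauchy v u \<Longrightarrow> \<exists>l\<in>Qp. is_v_limit v u l"
    and finite_extension:
      "\<exists>B. finite B \<and> (\<forall>x. \<exists>c. (\<forall>b\<in>B. c b \<in> Qp) \<and> x = (\<Sum>b\<in>B. c b * b))"

definition residue_norm :: "('k::field \<Rightarrow> int) \<Rightarrow> nat" where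
  "residue_norm v =
     card (integers_of v // {(x, y). x \<in> integers_of v \<and> y \<in> integers_of v \<and> x - y \<in> max_ideal v})"

text \<open>Meaningful for \<open>x\<close> in the ring of integers only.\<close>

definition eta :: "('k::field \<Rightarrow> int) \<Rightarrow> 'k \<Rightarrow> real" where
  "eta v x =
     (if x \<in> max_ideal v then - real (residue_norm v)
      else if \<exists>y\<in>integers_of v. x - y\<^sup>2 \<in> max_ideal v then 1 else - 1)"


section \<open>Binary lattice cosets\<close>

definition gram :: "('a \<Rightarrow> 'a \<Rightarrow> 'k) \<Rightarrow> (2 \<Rightarrow> 'a) \<Rightarrow> 'k^2^2" where
  "gram b e = (\<chi> i j. b (e i) (e j))"

text \<open>A quadratic space of dimension 2 with symmetric bilinear form \<open>b\<close> (the quadratic form is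
  \<open>x \<mapsto> b x x\<close>) and basis \<open>e 1, e 2\<close>; the lattice \<open>L\<close> spanned over the ring of integers by this
  basis; and the coset \<open>X = L + \<nu>\<close> with \<open>\<nu> = (s\<^sub>1 e\<^sub>1 + s\<^sub>2 e\<^sub>2) / \<pi>\<^sup>t\<^sup>m\<close>.\<close>

locale lattice_coset = padic_extension p Qp v + vector_space scale
  for p :: nat and Qp :: "'k::field_char_0 set" and v :: "'k \<Rightarrow> int"
    and scale :: "'k \<Rightarrow> 'a::ab_group_add \<Rightarrow> 'a" +
  fixes b :: "'a \<Rightarrow> 'a \<Rightarrow> 'k" and e :: "2 \<Rightarrow> 'a" and L :: "'a set"
    and \<pi> :: 'k and tm :: int and s :: "'k^2" and \<nu> :: 'a and X :: "'a set"
  assumes b_sym: "\<And>x y. b x y = b y x"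
    and b_add: "\<And>x y z. b (x + y) z = b x z + b y z"
    and b_scale: "\<And>c x y. b (scale c x) y = c * b x y"
    and basis: "inj e" "independent (range e)" "span (range e) = UNIV"
    and L_eq: "L = {(\<Sum>i\<in>UNIV. scale (a $ i) (e i)) | a. \<forall>i. a $ i \<in> integers_of v}"
    and uniformizer: "ordp v \<pi> = 1"
    and s_integral: "\<And>i. s $ i \<in> integers_of v"
    and s_unit: "\<exists>i. ordp v (s $ i) = 0"
    and \<nu>_eq: "\<nu> = scale (inverse (\<pi> powi tm)) (\<Sum>i\<in>UNIV. scale (s $ i) (e i))"
    and X_eq: "X = (\<lambda>x. x + \<nu>) ` L"


section \<open>The group \<open>O\<^sup>+(X, \<pp>\<^sup>t)\<close> and the local density\<close>

definition integral_mat :: "('k::field \<Rightarrow> int) \<Rightarrow> 'k^2^2 \<Rightarrow> bool" where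
  "integral_mat v M \<longleftrightarrow> (\<forall>i j. M $ i $ j \<in> integers_of v)"

definition mat_cong :: "('k::field \<Rightarrow> int) \<Rightarrow> int \<Rightarrow> 'k^2^2 \<Rightarrow> 'k^2^2 \<Rightarrow> bool" where
  "mat_cong v n A B \<longleftrightarrow> (\<forall>i j. A $ i $ j - B $ i $ j \<in> ppow v n)"

text \<open>Matrices over \<open>\<O>/\<pp>\<^sup>t\<close> are encoded as congruence classes of matrices over \<open>\<O>\<close>.\<close>

definition mat_cong_rel :: "('k::field \<Rightarrow> int) \<Rightarrow> int \<Rightarrow> (('k^2^2) \<times> ('k^2^2)) set" where
  "mat_cong_rel v n = {(A, B). integral_mat v A \<and> integral_mat v B \<and> mat_cong v n A B}"

definition GL2_lifts :: "('k::field \<Rightarrow> int) \<Rightarrow> nat \<Rightarrow> ('k^2^2) set" where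
  "GL2_lifts v t =
     {M. integral_mat v M \<and> (\<exists>u\<in>integers_of v. det M * u - 1 \<in> ppow v (int t))}"

text \<open>A class modulo \<open>\<pp>\<^sup>t\<close> belongs to \<open>O\<^sup>+(X, \<pp>\<^sup>t)\<close> if some representative satisfies the
  congruences, the first two of which are modulo \<open>\<pp>\<^sup>t\<^sup>+\<^sup>e\<close> with \<open>e = v 2\<close>. For \<open>v 2 = 0\<close> and
  \<open>t \<ge> tm\<close> this does not depend on the representative. Only the values for
  \<open>t \<ge> max tm (v 2 + 1)\<close> are meaningful, which is irrelevant for the limit below.\<close>

definition O_plus :: "('k::field \<Rightarrow> int) \<Rightarrow> 'k^2^2 \<Rightarrow> int \<Rightarrow> 'k^2 \<Rightarrow> nat \<Rightarrow> ('k^2^2) set set" where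
  "O_plus v G tm s t =
     {M \<in> GL2_lifts v t.
        mat_cong v (int t + v 2) (transpose M ** G ** M) G \<and>
        det M - 1 \<in> ppow v (int t + v 2) \<and>
        (\<forall>i. (M *v s) $ i - s $ i \<in> ppow v tm)}
     // mat_cong_rel v (int t)"

definition density_seq :: "('k::field \<Rightarrow> int) \<Rightarrow> 'k^2^2 \<Rightarrow> int \<Rightarrow> 'k^2 \<Rightarrow> nat \<Rightarrow> real" where
  "density_seq v G tm s t = real (card (O_plus v G tm s t)) / real (residue_norm v) ^ t"

text \<open>The density \<open>\<beta>\<^sup>+(X; X)\<close>, in terms of the Gram matrix \<open>G\<close> of \<open>L\<close> and the coordinates of
  \<open>\<nu>\<close>.\<close>

definition beta_plus :: "('k::field \<Rightarrow> int) \<Rightarrow> 'k^2^2 \<Rightarrow> int \<Rightarrow> 'k^2 \<Rightarrow> real" where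
  "beta_plus v G tm s = lim (density_seq v G tm s)"

end

theory Submission
  imports Defs
begin

text \<open>For \<open>\<pp> \<nmid> 2\<close> the matrices counted by \<open>O\<^sup>+(X, \<pp>\<^sup>t)\<close> have rows \<open>(a, - \<alpha> c)\<close> and \<open>(c, a)\<close> modulo
  \<open>\<pp>\<^sup>t\<close> with \<open>a\<^sup>2 + \<alpha> c\<^sup>2 = 1\<close>. Where \<open>a + 1\<close> is a unit, projection from \<open>(- 1, 0)\<close> parametrizes them
  bijectively by \<open>m = c / (a + 1)\<close> in \<open>\<O>/\<pp>\<^sup>t\<close> with \<open>1 + \<alpha> m\<^sup>2\<close> a unit, so no Hensel lifting is needed;
  the remaining ones are the negatives of those with \<open>a \<equiv> 1\<close>, for which \<open>\<alpha> m \<in> \<pp>\<close>. If \<open>tm = 0\<close>, it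
  remains to count residue classes of \<open>m\<close>: modulo \<open>\<pp>\<close>, \<open>1 + \<alpha> m\<^sup>2\<close> has two zeros if \<open>- \<alpha>\<close> is a square
  unit, and none otherwise. If \<open>tm \<ge> 1\<close>, fixing the
  coset forces \<open>a \<equiv> 1\<close> and becomes \<open>m s\<^sub>1, \<alpha> m s\<^sub>2 \<in> \<pp>\<^sup>t\<^sup>m\<close>, which says that \<open>m\<close> lies in
  \<open>\<pp>\<^sup>n\<close> with \<open>n = tm - min(tm, t\<^sub>\<nu>, t\<^sub>s)\<close>.\<close>

section \<open>Counting through maps with equal kernels\<close>

text \<open>Both images are in bijection with the quotient of \<open>S\<close> by the common kernel
  of \<open>f\<close> and \<open>g\<close>.\<close>

lemma card_image_cong_kernel:
  assumes "\<And>x y. x \<in> S \<Longrightarrow> y \<in> S \<Longrightarrow> f x = f y \<longleftrightarrow> g x = g y"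
  shows "card (f ` S) = card (g ` S)"
proof -
  have "bij_betw (\<lambda>c. g (SOME x. x \<in> S \<and> f x = c)) (f ` S) (g ` S)"
  proof (rule bij_betw_imageI)
    have pick: "(SOME z. z \<in> S \<and> f z = f x) \<in> S \<and> f (SOME z. z \<in> S \<and> f z = f x) = f x"
      if "x \<in> S" for x
      by (rule someI_ex) (use that in auto)
    then have gpick: "g (SOME z. z \<in> S \<and> f z = f x) = g x" if "x \<in> S" for x
      using assms that by blast
    show "inj_on (\<lambda>c. g (SOME x. x \<in> S \<and> f x = c)) (f ` S)"
      by (auto simp: inj_on_def gpick assms)
    show "(\<lambda>c. g (SOME x. x \<in> S \<and> f x = c)) ` f ` S = g ` S"
      by (auto simp: gpick image_image)
  qed
  then show ?thesis by (rule bij_betw_same_card)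
qed

text \<open>Serves for parametrizations \<open>f\<close> that reach \<open>A\<close> only up to
  congruence: \<open>g\<close> takes classes in the target and \<open>h\<close> classes of
  parameters.\<close>

lemma card_image_transport:
  assumes "\<And>x. x \<in> S \<Longrightarrow> f x \<in> A"
    and "\<And>x y. x \<in> S \<Longrightarrow> y \<in> S \<Longrightarrow> g (f x) = g (f y) \<longleftrightarrow> h x = h y"
    and "\<And>a. a \<in> A \<Longrightarrow> \<exists>x\<in>S. g (f x) = g a"
  shows "card (g ` A) = card (h ` S)"
proof -
  have "g ` A = (\<lambda>x. g (f x)) ` S"
  proof
    show "g ` A \<subseteq> (\<lambda>x. g (f x)) ` S" using assms(3) by (auto simp: image_iff) metis
    show "(\<lambda>x. g (f x)) ` S \<subseteq> g ` A" using assms(1) by auto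
  qed
  then show ?thesis using card_image_cong_kernel[of S "\<lambda>x. g (f x)" h] assms(2) by simp
qed

context padic_extension
begin

subsection \<open>Ideals and residue classes\<close>

lemma mem_ppow_iff: "x \<in> ppow v n \<longleftrightarrow> x = 0 \<or> n \<le> v x"
  by (auto simp: ppow_def ordp_def)

lemma integers_eq: "integers_of v = ppow v 0"
  by (auto simp: integers_of_def ppow_def zero_ereal_def)

lemma max_ideal_eq: "max_ideal v = ppow v 1"
  by (auto simp: max_ideal_def mem_ppow_iff ordp_def zero_ereal_def)

lemma v_one: "v 1 = 0"
  using v_mult[of 1 1] by simp

lemma v_minus_one: "v (- 1) = 0"
  using v_mult[of "- 1" "- 1"] v_one by simp

lemma v_inverse: "x \<noteq> 0 \<Longrightarrow> v (inverse x) = - v x"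
  using v_mult[of x "inverse x"] v_one by simp

lemma zero_mem_ppow [simp]: "0 \<in> ppow v n"
  by (simp add: mem_ppow_iff)

lemma ppow_add: "x \<in> ppow v n \<Longrightarrow> y \<in> ppow v n \<Longrightarrow> x + y \<in> ppow v n"
  using v_add[of x y] by (force simp: mem_ppow_iff)

lemma ppow_mult: "x \<in> ppow v m \<Longrightarrow> y \<in> ppow v n \<Longrightarrow> x * y \<in> ppow v (m + n)"
  by (cases "x = 0"; cases "y = 0") (use v_mult[of x y] in \<open>auto simp: mem_ppow_iff\<close>)

lemma ppow_mult_left: "x \<in> ppow v 0 \<Longrightarrow> y \<in> ppow v n \<Longrightarrow> x * y \<in> ppow v n"
  using ppow_mult[of x 0 y n] by simp

lemma ppow_mult_right: "x \<in> ppow v n \<Longrightarrow> y \<in> ppow v 0 \<Longrightarrow> x * y \<in> ppow v n"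
  using ppow_mult[of x n y 0] by simp

lemma ppow_uminus_iff [simp]: "- x \<in> ppow v n \<longleftrightarrow> x \<in> ppow v n"
  by (cases "x = 0") (use v_mult[of "- 1" x] v_minus_one in \<open>auto simp: mem_ppow_iff\<close>)

lemma ppow_diff: "x \<in> ppow v n \<Longrightarrow> y \<in> ppow v n \<Longrightarrow> x - y \<in> ppow v n"
  using ppow_add[of x n "- y"] by simp

lemma ppow_diff_commute: "x - y \<in> ppow v n \<longleftrightarrow> y - x \<in> ppow v n"
  using ppow_uminus_iff[of "x - y" n] by simp

lemma ppow_antimono: "x \<in> ppow v n \<Longrightarrow> m \<le> n \<Longrightarrow> x \<in> ppow v m"
  by (auto simp: mem_ppow_iff)

lemma one_mem_ppow [simp]: "1 \<in> ppow v 0" "1 \<notin> ppow v 1"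
  by (auto simp: mem_ppow_iff v_one)

lemma of_nat_mem_ppow [simp]: "of_nat k \<in> ppow v 0"
  by (induction k) (auto intro: ppow_add)

lemma of_int_mem_ppow [simp]: "of_int k \<in> ppow v 0"
  by (cases k rule: int_cases2) auto

lemma numeral_mem_ppow [simp]: "numeral k \<in> ppow v 0"
  using of_nat_mem_ppow[of "numeral k"] by simp

lemmas ppow_intros = ppow_add ppow_diff ppow_mult_left ppow_mult_right

lemma ppow_add_cancel_left: "x \<in> ppow v n \<Longrightarrow> x + y \<in> ppow v n \<longleftrightarrow> y \<in> ppow v n"
  using ppow_add[of x n y] ppow_diff[of "x + y" n x] by auto

text \<open>The two hypotheses on \<open>x\<close> say that \<open>x \<noteq> 0\<close> and
  \<open>v x = 0\<close>; units of \<O> are expressed by this pair of memberships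
  throughout.\<close>

lemma unit_mult_iff: "x \<in> ppow v 0 \<Longrightarrow> x \<notin> ppow v 1 \<Longrightarrow> x * y \<in> ppow v n \<longleftrightarrow> y \<in> ppow v n"
  by (cases "x = 0"; cases "y = 0") (use v_mult[of x y] in \<open>auto simp: mem_ppow_iff\<close>)

lemma unit_inverse: "x \<in> ppow v 0 \<Longrightarrow> x \<notin> ppow v 1 \<Longrightarrow> inverse x \<in> ppow v 0 \<and> inverse x \<notin> ppow v 1"
  using v_inverse[of x] by (auto simp: mem_ppow_iff)

lemma unit_divide_iff: "x \<in> ppow v 0 \<Longrightarrow> x \<notin> ppow v 1 \<Longrightarrow> y / x \<in> ppow v n \<longleftrightarrow> y \<in> ppow v n"
  using unit_mult_iff[of "inverse x" y n] unit_inverse[of x] by (simp add: field_simps)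

lemma prime_ideal:
  "x \<in> ppow v 0 \<Longrightarrow> y \<in> ppow v 0 \<Longrightarrow> x * y \<in> ppow v 1 \<longleftrightarrow> x \<in> ppow v 1 \<or> y \<in> ppow v 1"
  by (cases "x = 0"; cases "y = 0") (use v_mult[of x y] in \<open>auto simp: mem_ppow_iff\<close>)

section \<open>Congruence classes and finiteness of the residue field\<close>

text \<open>The coset is taken in all of \<open>'k\<close>, not only in \<O>, so that
  \<open>cls_eq_iff\<close> holds without integrality conditions.\<close>

definition cls :: "int \<Rightarrow> 'k \<Rightarrow> 'k set" where
  "cls n x = {y. y - x \<in> ppow v n}"

lemma cls_eq_iff: "cls n x = cls n y \<longleftrightarrow> x - y \<in> ppow v n"
proof
  assume "cls n x = cls n y"
  moreover have "x \<in> cls n x" by (simp add: cls_def)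
  ultimately show "x - y \<in> ppow v n" by (simp add: cls_def)
next
  assume *: "x - y \<in> ppow v n"
  have "z - x \<in> ppow v n \<longleftrightarrow> z - y \<in> ppow v n" for z
    using ppow_add_cancel_left[OF *, of "z - x"] by simp
  then show "cls n x = cls n y" by (simp add: cls_def)
qed

text \<open>Because \<pp> lies in \<O>, a class of the relation defining \<open>residue_norm\<close>
  is a full coset of \<pp>, so the quotient is an image under \<open>cls 1\<close>.\<close>

lemma residue_norm_eq: "residue_norm v = card (cls 1 ` ppow v 0)"
proof -
  let ?r = "{(x, y). x \<in> ppow v 0 \<and> y \<in> ppow v 0 \<and> x - y \<in> ppow v 1}"
  have "ppow v 0 // ?r = (\<lambda>x. ?r `` {x}) ` ppow v 0"
    by (auto simp: quotient_def)
  moreover have "card ((\<lambda>x. ?r `` {x}) ` ppow v 0) = card (cls 1 ` ppow v 0)"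
  proof (rule card_image_cong_kernel)
    fix x y assume xy: "x \<in> ppow v 0" "y \<in> ppow v 0"
    have "?r `` {z} = cls 1 z" if "z \<in> ppow v 0" for z
    proof -
      have "w \<in> ppow v 0" if "w - z \<in> ppow v 1" for w
        using ppow_add[OF ppow_antimono[OF that, of 0] \<open>z \<in> ppow v 0\<close>] by simp
      then show ?thesis using that by (auto simp: cls_def ppow_diff_commute)
    qed
    then show "?r `` {x} = ?r `` {y} \<longleftrightarrow> cls 1 x = cls 1 y" using xy by simp
  qed
  ultimately show ?thesis by (simp add: residue_norm_def integers_eq max_ideal_eq)
qed

text \<open>If \<open>p\<close> did not divide \<open>k\<close>, Bezout would write 1 as a
  combination of two elements of \<pp>.\<close>

lemma of_int_mem_max_ideal_iff: "of_int k \<in> ppow v 1 \<longleftrightarrow> int p dvd k"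
proof
  have p1: "of_nat p \<in> ppow v 1" using v_p by (simp add: mem_ppow_iff)
  show "of_int k \<in> ppow v 1" if "int p dvd k"
  proof -
    from that obtain j where "k = int p * j" by (rule dvdE)
    then show ?thesis using ppow_mult_right[OF p1, of "of_int j"] by simp
  qed
  show "int p dvd k" if k: "of_int k \<in> ppow v 1"
  proof (rule ccontr)
    assume "\<not> int p dvd k"
    then have "coprime (int p) k" using prime_p by (simp add: prime_imp_coprime)
    then obtain a b where "a * int p + b * k = 1" using bezout_int[of "int p" k] by auto
    then have "of_int (a * int p + b * k) = (1::'k)" by simp
    then have "of_int a * of_nat p + of_int b * of_int k = (1::'k)" by simp
    moreover have "of_int a * of_nat p + of_int b * of_int k \<in> ppow v 1"
      using p1 k by (intro ppow_add ppow_mult_left) auto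
    ultimately show False by simp
  qed
qed

text \<open>By density \<open>z\<close> can be replaced by a rational a/b. Its denominator is prime
  to \<open>p\<close>, and \<open>k\<close> is a times an inverse of b modulo
  \<open>p\<close>.\<close>

lemma Qp_residue:
  assumes "z \<in> Qp" "z \<in> ppow v 0"
  shows "\<exists>k<p. z - of_nat k \<in> ppow v 1"
proof -
  obtain r where r: "r \<in> \<rat>" "z - r \<in> ppow v 1" using Rats_dense[OF assms(1)] by blast
  have r0: "r \<in> ppow v 0"
    using ppow_diff[OF assms(2) ppow_antimono[OF r(2), of 0]] by simp
  obtain a b where ab: "b > 0" "coprime a b" "r = of_int a / of_int b"
    using r(1) by (rule Rats_cases')
  have b0: "(of_int b :: 'k) \<noteq> 0" using ab by simp
  have pb: "\<not> int p dvd b"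
  proof
    assume *: "int p dvd b"
    then have "r * of_int b \<in> ppow v 1" using r0 of_int_mem_max_ideal_iff by (intro ppow_mult_left) auto
    then have "int p dvd a" using ab b0 of_int_mem_max_ideal_iff by simp
    then have "int p dvd 1" using * ab(2) by (meson coprime_common_divisor)
    then show False using prime_p by (metis not_prime_unit prime_nat_int_transfer)
  qed
  then have "coprime (int p) b" using prime_p by (simp add: prime_imp_coprime)
  then obtain x y where xy: "x * int p + y * b = 1" using bezout_int[of "int p" b] by auto
  define k where "k = nat ((a * y) mod int p)"
  have p0: "p > 0" using prime_p prime_gt_0_nat by blast
  then have kp: "int k = (a * y) mod int p" by (simp add: k_def)
  have "k < p" using p0 kp by (metis of_nat_less_iff pos_mod_bound of_nat_0_less_iff)
  moreover have "z - of_nat k \<in> ppow v 1"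
  proof -
    have "int p dvd a - b * int k"
    proof -
      have "int p dvd a * y - int k" using kp by (simp add: mod_eq_dvd_iff[symmetric])
      \<comment> \<open>Obtained by multiplying \<open>a\<close> by the Bezout identity
        \<open>x * int p + y * b = 1\<close>.\<close>
      moreover have "a - b * int k = a * (x * int p) + b * (a * y - int k)"
      proof -
        have "a = a * (x * int p + y * b)" using xy by simp
        then show ?thesis by (simp add: algebra_simps)
      qed
      ultimately show ?thesis by simp
    qed
    then have "of_int (a - b * int k) \<in> ppow v 1" by (simp only: of_int_mem_max_ideal_iff)
    moreover have "of_int (a - b * int k) = of_int b * (r - of_nat k)"
      using ab b0 by (simp add: field_simps)
    ultimately have "r - of_nat k \<in> ppow v 1"
      using unit_mult_iff[of "of_int b" "r - of_nat k" 1] pb of_int_mem_max_ideal_iff[of b] by simp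
    then show ?thesis using ppow_add[OF r(2), of "r - of_nat k"] by simp
  qed
  ultimately show ?thesis by blast
qed

definition qspan :: "'k set \<Rightarrow> 'k set" where
  "qspan B = {x. \<exists>c. (\<forall>b\<in>B. c b \<in> Qp) \<and> x = (\<Sum>b\<in>B. c b * b)}"

lemma qspan_diff_scale:
  assumes "x \<in> qspan B" "y \<in> qspan B" "r \<in> Qp"
  shows "x - r * y \<in> qspan B"
proof -
  obtain c d where "\<forall>b\<in>B. c b \<in> Qp" "x = (\<Sum>b\<in>B. c b * b)"
    "\<forall>b\<in>B. d b \<in> Qp" "y = (\<Sum>b\<in>B. d b * b)"
    using assms by (auto simp: qspan_def)
  then show ?thesis using assms(3)
    by (auto simp: qspan_def sum_distrib_left sum_subtractf algebra_simps
        intro!: exI[of _ "\<lambda>b. c b - r * d b"] Qp_diff Qp_mult)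
qed

text \<open>If \<open>\<lambda>\<^sub>y\<close> is the coordinate of \<open>y\<close> at the new basis vector, then among finitely many \<open>y\<close> one with
  minimal \<open>v \<lambda>\<^sub>y\<close> generates all residue classes modulo those of the smaller span.\<close>

lemma finite_residues_qspan:
  "finite B \<Longrightarrow> finite (cls 1 ` (qspan B \<inter> ppow v 0))"
proof (induction B rule: finite_induct)
  case empty
  have "qspan {} \<inter> ppow v 0 \<subseteq> {0}" by (auto simp: qspan_def)
  then show ?case by (meson finite.emptyI finite.insertI finite_imageI finite_subset)
next
  case (insert b B)
  let ?V = "cls 1 ` (qspan B \<inter> ppow v 0)"
  have dec: "\<exists>l. l \<in> Qp \<and> x - l * b \<in> qspan B" if x: "x \<in> qspan (insert b B)" for x
  proof -
    obtain c where c: "\<forall>a\<in>insert b B. c a \<in> Qp" "x = (\<Sum>a\<in>insert b B. c a * a)"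
      using x by (auto simp: qspan_def)
    then have "x - c b * b = (\<Sum>a\<in>B. c a * a)" using insert.hyps by simp
    then show ?thesis using c(1) by (auto simp: qspan_def)
  qed
  \<comment> \<open>Bounding all finite sets of classes proves finiteness while comparing only
    finitely many representatives, so a coordinate of least valuation exists. The second summand
    covers the case that all coordinates vanish.\<close>
  have "card F \<le> p * card ?V + card ?V"
    if F: "F \<subseteq> cls 1 ` (qspan (insert b B) \<inter> ppow v 0)" "finite F" for F
  proof -
    obtain Y where Y: "Y \<subseteq> qspan (insert b B) \<inter> ppow v 0" "finite Y" "F = cls 1 ` Y"
      using finite_subset_image[OF F(2,1)] by blast
    have "\<exists>l. \<forall>x\<in>Y. l x \<in> Qp \<and> x - l x * b \<in> qspan B"
      using dec Y(1) by (intro bchoice) auto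
    then obtain l where l: "\<And>x. x \<in> Y \<Longrightarrow> l x \<in> Qp" "\<And>x. x \<in> Y \<Longrightarrow> x - l x * b \<in> qspan B"
      by blast
    show ?thesis
    proof (cases "\<forall>y\<in>Y. l y = 0")
      case True
      then have "F \<subseteq> ?V" using Y l by force
      then show ?thesis using card_mono[OF insert.IH, of F] by simp
    next
      case False
      define Z where "Z = {y\<in>Y. l y \<noteq> 0}"
      have Z: "finite Z" "Z \<noteq> {}" using False Y(2) by (auto simp: Z_def)
      define x where "x = arg_min_on (\<lambda>y. v (l y)) Z"
      have x: "x \<in> Z" "\<And>y. y \<in> Z \<Longrightarrow> v (l x) \<le> v (l y)"
        using arg_min_if_finite(1)[OF Z] arg_min_least[OF Z] by (auto simp: x_def)
      have xY: "x \<in> Y" and lx: "l x \<noteq> 0" using x by (auto simp: Z_def)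
      have "F \<subseteq> (\<Union>k<p. (\<lambda>w. cls 1 (of_nat k * x + w)) ` (qspan B \<inter> ppow v 0))"
      proof
        fix C assume "C \<in> F"
        then obtain y where y: "y \<in> Y" "C = cls 1 y" using Y by auto
        \<comment> \<open>\<open>l x\<close> has the least valuation among the nonzero coordinates,
          so \<open>r\<close> is integral; subtracting \<open>r * x\<close> cancels the component of
          \<open>y\<close> along \<open>b\<close>.\<close>
        define r where "r = l y * inverse (l x)"
        have rQ: "r \<in> Qp" using y xY l unfolding r_def by (intro Qp_mult Qp_inverse) auto
        have r0: "r \<in> ppow v 0"
        proof (cases "l y = 0")
          case False
          then have "v (l x) \<le> v (l y)" using x y by (auto simp: Z_def)
          then show ?thesis using False lx v_mult[of "l y" "inverse (l x)"] v_inverse[of "l x"]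
            by (simp add: r_def mem_ppow_iff)
        qed (simp add: r_def)
        obtain k where k: "k < p" "r - of_nat k \<in> ppow v 1" using Qp_residue[OF rQ r0] by blast
        have "y - l y * b - r * (x - l x * b) \<in> qspan B"
          using qspan_diff_scale[OF l(2)[OF y(1)] l(2)[OF xY] rQ] .
        moreover have "y - l y * b - r * (x - l x * b) = y - r * x"
          using lx by (simp add: r_def field_simps)
        ultimately have "y - r * x \<in> qspan B" by simp
        moreover have "y - r * x \<in> ppow v 0" using y xY Y(1) r0 by (intro ppow_intros) auto
        moreover have "C = cls 1 (of_nat k * x + (y - r * x))"
        proof -
          have "y - (of_nat k * x + (y - r * x)) = (r - of_nat k) * x" by (simp add: algebra_simps)
          moreover have "(r - of_nat k) * x \<in> ppow v 1" using k xY Y by (intro ppow_mult_right) auto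
          ultimately show ?thesis using y by (simp add: cls_eq_iff)
        qed
        ultimately show "C \<in> (\<Union>k<p. (\<lambda>w. cls 1 (of_nat k * x + w)) ` (qspan B \<inter> ppow v 0))"
          using k by auto
      qed
      \<comment> \<open>Translation by \<open>of_nat k * x\<close> permutes the cosets of \<pp>, so
        each \<open>k\<close> contributes at most \<open>card ?V\<close> classes.\<close>
      moreover have eq: "(\<lambda>w. cls 1 (of_nat k * x + w)) ` (qspan B \<inter> ppow v 0) =
          (\<lambda>C. (\<lambda>z. of_nat k * x + z) ` C) ` ?V" for k
      proof -
        have "cls 1 (z + w) = (\<lambda>u. z + u) ` cls 1 w" for z w
        proof (intro equalityI subsetI)
          fix u assume "u \<in> cls 1 (z + w)"
          then show "u \<in> (\<lambda>u. z + u) ` cls 1 w"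
            by (intro image_eqI[of _ _ "u - z"]) (auto simp: cls_def algebra_simps)
        qed (auto simp: cls_def)
        then show ?thesis by (simp add: image_image)
      qed
      ultimately have "card F \<le> card (\<Union>k<p. (\<lambda>w. cls 1 (of_nat k * x + w)) ` (qspan B \<inter> ppow v 0))"
        using insert.IH by (intro card_mono) auto
      also have "\<dots> \<le> (\<Sum>k<p. card ((\<lambda>w. cls 1 (of_nat k * x + w)) ` (qspan B \<inter> ppow v 0)))"
        by (rule card_UN_le) simp
      also have "\<dots> \<le> (\<Sum>k<p. card ?V)"
        by (intro sum_mono, subst eq) (rule card_image_le[OF insert.IH])
      finally show ?thesis by simp
    qed
  qed
  then show ?case using finite_if_finite_subsets_card_bdd by blast
qed

lemma finite_residues: "finite (cls 1 ` ppow v 0)"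
proof -
  obtain B where "finite B" "\<And>x. x \<in> qspan B"
    using finite_extension by (auto simp: qspan_def)
  then show ?thesis using finite_residues_qspan[of B]
    by (metis Int_commute Int_absorb2 subsetI)
qed

lemma residue_norm_pos: "residue_norm v > 0"
  using finite_residues by (auto simp: residue_norm_eq card_gt_0_iff) (use zero_mem_ppow in blast)

section \<open>Number of classes modulo a power of the prime\<close>

text \<open>With \<open>v w = 1\<close>, the map \<open>\<lambda>y. x0 + w ^ n * y\<close> carries
  \<O> modulo \<pp>^t onto x0 + \<pp>^n modulo \<pp>^(n+t).\<close>

lemma card_cls_coset_shift:
  "card (cls (int n + t) ` {x. x - x0 \<in> ppow v (int n)}) = card (cls t ` ppow v 0)"
proof -
  obtain w where w: "w \<noteq> 0" "v w = 1" using v_normalized by blast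
  have vw: "v (w ^ n) = int n"
    by (induction n) (use w v_mult v_one in auto)
  have scale: "w ^ n * y \<in> ppow v (int n + m) \<longleftrightarrow> y \<in> ppow v m" for y m
    by (cases "y = 0") (use w vw v_mult[of "w ^ n" y] in \<open>auto simp: mem_ppow_iff\<close>)
  show ?thesis
  proof (rule card_image_transport[where f = "\<lambda>y. x0 + w ^ n * y"])
    show "x0 + w ^ n * y \<in> {x. x - x0 \<in> ppow v (int n)}" if "y \<in> ppow v 0" for y
      using that scale[of y 0] by simp
    show "cls (int n + t) (x0 + w ^ n * x) = cls (int n + t) (x0 + w ^ n * y) \<longleftrightarrow> cls t x = cls t y" for x y
      using scale[of "x - y" t] by (simp add: cls_eq_iff algebra_simps)
    show "\<exists>y\<in>ppow v 0. cls (int n + t) (x0 + w ^ n * y) = cls (int n + t) a"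
      if "a \<in> {x. x - x0 \<in> ppow v (int n)}" for a
    proof (rule bexI[of _ "(a - x0) / w ^ n"])
      show "(a - x0) / w ^ n \<in> ppow v 0"
        using that w scale[of "(a - x0) / w ^ n" 0] by simp
    qed (use w in simp)
  qed
qed

text \<open>Induction: \<O> is the disjoint union of its residue classes modulo \<pp>, and each of
  these, a shifted and scaled copy of \<O>, splits into as many classes modulo \<pp>^(t+1) as \<O>
  does modulo \<pp>^t.\<close>

lemma card_cls_integers: "card (cls (int t) ` ppow v 0) = residue_norm v ^ t"
proof (induction t)
  case 0
  have "cls 0 ` ppow v 0 = {ppow v 0}"
  proof -
    have "cls 0 x = cls 0 0" if "x \<in> ppow v 0" for x using that by (simp add: cls_eq_iff)
    moreover have "cls 0 0 = ppow v 0" by (simp add: cls_def)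
    ultimately show ?thesis using zero_mem_ppow by blast
  qed
  then show ?case by simp
next
  case (Suc t)
  let ?c = "cls (int (Suc t))"
  have each: "finite (?c ` C) \<and> card (?c ` C) = residue_norm v ^ t" if C: "C \<in> cls 1 ` ppow v 0" for C
  proof -
    obtain x0 where "C = {x. x - x0 \<in> ppow v (int 1)}" using C by (auto simp: cls_def)
    then have "card (?c ` C) = residue_norm v ^ t"
      using card_cls_coset_shift[of 1 "int t" x0] Suc.IH by simp
    then show ?thesis using residue_norm_pos by (metis card_ge_0_finite zero_less_power)
  qed
  have "(\<Union>(cls 1 ` ppow v 0)) = ppow v 0"
  proof
    show "\<Union>(cls 1 ` ppow v 0) \<subseteq> ppow v 0"
    proof
      fix x assume "x \<in> \<Union>(cls 1 ` ppow v 0)"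
      then obtain y where "y \<in> ppow v 0" "x - y \<in> ppow v 1" by (auto simp: cls_def)
      then show "x \<in> ppow v 0" using ppow_add[of y 0 "x - y"] ppow_antimono[of "x - y" 1 0] by simp
    qed
    show "ppow v 0 \<subseteq> \<Union>(cls 1 ` ppow v 0)" by (auto simp: cls_def)
  qed
  then have "?c ` ppow v 0 = (\<Union>C\<in>cls 1 ` ppow v 0. ?c ` C)" by (metis image_Union)
  also have "card \<dots> = (\<Sum>C\<in>cls 1 ` ppow v 0. card (?c ` C))"
  proof (rule card_UN_disjoint[OF finite_residues])
    show "\<forall>C\<in>cls 1 ` ppow v 0. finite (?c ` C)" using each by blast
    show "\<forall>C\<in>cls 1 ` ppow v 0. \<forall>D\<in>cls 1 ` ppow v 0. C \<noteq> D \<longrightarrow> ?c ` C \<inter> ?c ` D = {}"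
    proof (intro ballI impI, rule ccontr)
      fix C D assume "C \<in> cls 1 ` ppow v 0" "D \<in> cls 1 ` ppow v 0" "C \<noteq> D" "?c ` C \<inter> ?c ` D \<noteq> {}"
      then obtain x y a b where xy: "C = cls 1 x" "D = cls 1 y" "a \<in> C" "b \<in> D" "?c a = ?c b"
        by auto
      then have "a - b \<in> ppow v 1" using ppow_antimono[of "a - b" "int (Suc t)" 1] by (simp add: cls_eq_iff)
      then have "cls 1 a = cls 1 b" by (simp add: cls_eq_iff)
      moreover have "cls 1 a = C" "cls 1 b = D" using xy by (auto simp: cls_eq_iff) (auto simp: cls_def)
      ultimately show False using \<open>C \<noteq> D\<close> by simp
    qed
  qed
  also have "\<dots> = residue_norm v ^ Suc t" using each by (simp add: residue_norm_eq)
  finally show ?case .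
qed

lemma card_cls_coset:
  assumes "n \<le> t"
  shows "card (cls (int t) ` {x. x - x0 \<in> ppow v (int n)}) = residue_norm v ^ (t - n)"
  using card_cls_coset_shift[of n "int (t - n)" x0] card_cls_integers[of "t - n"] assms by simp

lemma finite_cls_integers: "finite (cls (int t) ` ppow v 0)"
  using card_cls_integers[of t] residue_norm_pos by (intro card_ge_0_finite) simp

text \<open>For \<open>t \<ge> 1\<close>, congruence modulo \<pp>^t implies congruence modulo \<pp>,
  so \<open>A\<close> and \<open>B\<close> share no class.\<close>

lemma card_cls_Un:
  assumes t: "t \<ge> 1" and AB: "A \<subseteq> ppow v 0" "B \<subseteq> ppow v 0"
    and disj: "\<And>x y. x \<in> A \<Longrightarrow> y \<in> B \<Longrightarrow> x - y \<notin> ppow v 1"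
  shows "card (cls (int t) ` (A \<union> B)) = card (cls (int t) ` A) + card (cls (int t) ` B)"
proof -
  have "cls (int t) ` A \<inter> cls (int t) ` B = {}"
    using disj ppow_antimono[where m = 1 and n = "int t"] t by (fastforce simp: cls_eq_iff)
  moreover have "finite (cls (int t) ` A)" "finite (cls (int t) ` B)"
    using finite_cls_integers AB by (meson finite_subset image_mono)+
  ultimately show ?thesis by (simp add: image_Un card_Un_disjoint)
qed

lemma card_cls_residue_class:
  "t \<ge> 1 \<Longrightarrow> card (cls (int t) ` {x. x - x0 \<in> ppow v 1}) = residue_norm v ^ (t - 1)"
  using card_cls_coset[of 1 t x0] by simp


subsection \<open>The special orthogonal group modulo a power of the prime\<close>

definition mcls :: "int \<Rightarrow> 'k^2^2 \<Rightarrow> ('k^2^2) set" where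
  "mcls n M = mat_cong_rel v n `` {M}"

lemma integral_mat_iff:
  "integral_mat v (M :: 'k^2^2) \<longleftrightarrow>
    M $ 1 $ 1 \<in> ppow v 0 \<and> M $ 1 $ 2 \<in> ppow v 0 \<and> M $ 2 $ 1 \<in> ppow v 0 \<and> M $ 2 $ 2 \<in> ppow v 0"
  by (auto simp: integral_mat_def integers_eq forall_2)

lemma mat_cong_iff:
  "mat_cong v n (A :: 'k^2^2) B \<longleftrightarrow>
    A $ 1 $ 1 - B $ 1 $ 1 \<in> ppow v n \<and> A $ 1 $ 2 - B $ 1 $ 2 \<in> ppow v n \<and>
    A $ 2 $ 1 - B $ 2 $ 1 \<in> ppow v n \<and> A $ 2 $ 2 - B $ 2 $ 2 \<in> ppow v n"
  by (auto simp: mat_cong_def forall_2)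

lemma mcls_eq_iff:
  assumes "integral_mat v A" "integral_mat v B"
  shows "mcls n A = mcls n B \<longleftrightarrow> mat_cong v n A B"
proof
  have "A \<in> mcls n A" using assms by (simp add: mcls_def mat_cong_rel_def mat_cong_def)
  moreover assume "mcls n A = mcls n B"
  ultimately have "A \<in> mcls n B" by simp
  then have "mat_cong v n B A" by (simp add: mcls_def mat_cong_rel_def)
  then show "mat_cong v n A B" by (simp add: mat_cong_def ppow_diff_commute)
next
  assume *: "mat_cong v n A B"
  have "A $ i $ j - x \<in> ppow v n \<longleftrightarrow> B $ i $ j - x \<in> ppow v n" for i j x
    using ppow_add_cancel_left[of "A $ i $ j - B $ i $ j" n "B $ i $ j - x"] * by (simp add: mat_cong_def)
  then show "mcls n A = mcls n B" using assms by (simp add: mcls_def mat_cong_rel_def mat_cong_def)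
qed

text \<open>A set of matrices over \<O>, not of classes, which \<open>mcls\<close> takes later.
  These are the isometry and determinant congruences of \<open>O_plus\<close> for
  \<open>v 2 = 0\<close>.\<close>

definition so2 :: "'k \<Rightarrow> int \<Rightarrow> ('k^2^2) set" where
  "so2 \<alpha> n = {M. integral_mat v M \<and>
     mat_cong v n (transpose M ** vector [vector [1, 0], vector [0, \<alpha>]] ** M)
       (vector [vector [1, 0], vector [0, \<alpha>]]) \<and> det M - 1 \<in> ppow v n}"

lemma so2_integral: "M \<in> so2 \<alpha> n \<Longrightarrow> integral_mat v M"
  by (simp add: so2_def)

text \<open>For det M = 1 the equation M^T G M = G reads G M = adj(M)^T G, whose first row says that
  M has rows (a, -\<alpha> c) and (c, a). The explicit combinations below carry this over to
  congruences.\<close>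

lemma so2_iff:
  assumes "\<alpha> \<in> ppow v 0"
  shows "M \<in> so2 \<alpha> n \<longleftrightarrow> integral_mat v M \<and> M $ 1 $ 2 + \<alpha> * M $ 2 $ 1 \<in> ppow v n \<and>
    M $ 2 $ 2 - M $ 1 $ 1 \<in> ppow v n \<and> (M $ 1 $ 1)\<^sup>2 + \<alpha> * (M $ 2 $ 1)\<^sup>2 - 1 \<in> ppow v n"
proof (cases "integral_mat v M")
  case True
  define a b c d where abcd: "a = M $ 1 $ 1" "b = M $ 1 $ 2" "c = M $ 2 $ 1" "d = M $ 2 $ 2"
  have int: "a \<in> ppow v 0" "b \<in> ppow v 0" "c \<in> ppow v 0" "d \<in> ppow v 0"
    using True by (auto simp: integral_mat_iff abcd)
  \<comment> \<open>The defects of the equations M^T G M = G and det M = 1.\<close>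
  define x1 x2 x3 x4 where x: "x1 = a\<^sup>2 + \<alpha> * c\<^sup>2 - 1" "x2 = a * b + \<alpha> * c * d"
    "x3 = b\<^sup>2 + \<alpha> * d\<^sup>2 - \<alpha>" "x4 = a * d - b * c - 1"
  have "transpose M ** vector [vector [1, 0], vector [0, \<alpha>]] ** M =
      vector [vector [x1 + 1, x2], vector [x2, x3 + \<alpha>]]"
    by (simp add: vec_eq_iff forall_2 matrix_matrix_mult_def transpose_def sum_2 abcd[symmetric] x
        power2_eq_square mult.commute mult.left_commute)
  then have "M \<in> so2 \<alpha> n \<longleftrightarrow> x1 \<in> ppow v n \<and> x2 \<in> ppow v n \<and> x3 \<in> ppow v n \<and> x4 \<in> ppow v n"
    using True by (simp add: so2_def mat_cong_iff det_2 abcd[symmetric] x(4))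
  also have "\<dots> \<longleftrightarrow> b + \<alpha> * c \<in> ppow v n \<and> d - a \<in> ppow v n \<and> x1 \<in> ppow v n" (is "_ \<longleftrightarrow> ?R")
  proof
    assume x4: "x1 \<in> ppow v n \<and> x2 \<in> ppow v n \<and> x3 \<in> ppow v n \<and> x4 \<in> ppow v n"
    have "b + \<alpha> * c = a * x2 - b * x1 - \<alpha> * c * x4" "d - a = c * x2 - d * x1 + a * x4"
      by (simp_all add: x algebra_simps power2_eq_square)
    moreover have "a * x2 - b * x1 - \<alpha> * c * x4 \<in> ppow v n" "c * x2 - d * x1 + a * x4 \<in> ppow v n"
      using x4 int assms by (auto intro!: ppow_add ppow_diff ppow_mult_left)
    ultimately show ?R using x4 by simp
  next
    assume r: ?R
    define y z where yz: "y = b + \<alpha> * c" "z = d - a"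
    have "x2 = a * y + \<alpha> * c * z" "x3 = b * y - \<alpha> * c * y + \<alpha> * d * z + \<alpha> * a * z + \<alpha> * x1"
      "x4 = x1 + a * z - c * y"
      by (simp_all add: x yz algebra_simps power2_eq_square)
    moreover have "a * y + \<alpha> * c * z \<in> ppow v n"
      "b * y - \<alpha> * c * y + \<alpha> * d * z + \<alpha> * a * z + \<alpha> * x1 \<in> ppow v n" "x1 + a * z - c * y \<in> ppow v n"
      using r[folded yz] int assms by (auto intro!: ppow_add ppow_diff ppow_mult_left)
    ultimately show "x1 \<in> ppow v n \<and> x2 \<in> ppow v n \<and> x3 \<in> ppow v n \<and> x4 \<in> ppow v n"
      using r by simp
  qed
  finally show ?thesis using True by (simp add: abcd x)
qed (simp add: so2_def)

section \<open>Rational parametrization of the conic\<close>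

text \<open>The parameter \<open>m = c / (a + 1)\<close> is the slope of the line through \<open>(- 1, 0)\<close> and the point
  \<open>(a, c)\<close> of the conic \<open>a\<^sup>2 + \<alpha> c\<^sup>2 = 1\<close>.\<close>

definition rot :: "'k \<Rightarrow> 'k \<Rightarrow> 'k^2^2" where
  "rot \<alpha> m = (let D = 1 + \<alpha> * m\<^sup>2; a = (1 - \<alpha> * m\<^sup>2) / D; c = 2 * m / D
    in vector [vector [a, - (\<alpha> * c)], vector [c, a]])"

lemma rot_entries:
  "rot \<alpha> m $ 1 $ 1 = (1 - \<alpha> * m\<^sup>2) / (1 + \<alpha> * m\<^sup>2)"
  "rot \<alpha> m $ 2 $ 1 = 2 * m / (1 + \<alpha> * m\<^sup>2)"
  "rot \<alpha> m $ 1 $ 2 = - (\<alpha> * rot \<alpha> m $ 2 $ 1)"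
  "rot \<alpha> m $ 2 $ 2 = rot \<alpha> m $ 1 $ 1"
  by (simp_all add: rot_def Let_def)

context
  fixes \<alpha> :: 'k
  assumes two: "2 \<notin> ppow v 1" and \<alpha>: "\<alpha> \<in> ppow v 0"
begin

text \<open>The identity (1 - \<alpha> m^2)^2 + \<alpha> (2 m)^2 = D^2 is exact, so one matrix
  serves for every \<open>n\<close>; D being a unit keeps the entries integral.\<close>

lemma rot_mem_so2:
  assumes m: "m \<in> ppow v 0" and D: "1 + \<alpha> * m\<^sup>2 \<notin> ppow v 1"
  shows "rot \<alpha> m \<in> so2 \<alpha> n"
proof -
  define D where "D = 1 + \<alpha> * m\<^sup>2"
  have D0: "D \<in> ppow v 0" "D \<notin> ppow v 1" "1 - \<alpha> * m\<^sup>2 \<in> ppow v 0" "2 * m \<in> ppow v 0"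
    using m D \<alpha> by (auto simp: D_def power2_eq_square intro!: ppow_intros)
  have Dnz: "D \<noteq> 0" using D0 by auto
  have "(1 - \<alpha> * m\<^sup>2)\<^sup>2 + \<alpha> * (2 * m)\<^sup>2 = D\<^sup>2"
    by (simp add: D_def algebra_simps power2_eq_square)
  then have "((1 - \<alpha> * m\<^sup>2) / D)\<^sup>2 + \<alpha> * (2 * m / D)\<^sup>2 - 1 = 0"
    using Dnz by (simp add: field_simps)
  moreover have "(1 - \<alpha> * m\<^sup>2) / D \<in> ppow v 0" "2 * m / D \<in> ppow v 0"
    using D0 by (simp_all add: unit_divide_iff)
  moreover from this(2) have "\<alpha> * (2 * m / D) \<in> ppow v 0" using \<alpha> by (rule ppow_mult_left[rotated])
  ultimately show ?thesis
    unfolding so2_iff[OF \<alpha>] integral_mat_iff rot_entries by (simp add: D_def)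
qed

text \<open>Up to the units 2, D and D', the differences of the first-column entries are D' - D and
  m D' - m' D. Both lie in \<pp>^n if m - m' does; conversely (m D' - m' D) - m (D' - D) = D (m -
  m').\<close>

lemma rot_cong_iff:
  assumes m: "m \<in> ppow v 0" "1 + \<alpha> * m\<^sup>2 \<notin> ppow v 1" and m': "m' \<in> ppow v 0" "1 + \<alpha> * m'\<^sup>2 \<notin> ppow v 1"
  shows "mat_cong v n (rot \<alpha> m) (rot \<alpha> m') \<longleftrightarrow> m - m' \<in> ppow v n"
proof -
  define D D' where "D = 1 + \<alpha> * m\<^sup>2" and "D' = 1 + \<alpha> * m'\<^sup>2"
  have D: "D \<in> ppow v 0" "D \<notin> ppow v 1" "D' \<in> ppow v 0" "D' \<notin> ppow v 1"
    using m m' \<alpha> by (auto simp: D_def D'_def power2_eq_square intro!: ppow_intros)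
  have nz: "D \<noteq> 0" "D' \<noteq> 0" using D by auto
  define a a' c c' where a: "a = (1 - \<alpha> * m\<^sup>2) / D" "a' = (1 - \<alpha> * m'\<^sup>2) / D'"
    and c: "c = 2 * m / D" "c' = 2 * m' / D'"
  have "2 * (D' - D) = D * D' * (a - a')"
    using nz by (simp add: a field_simps) (simp add: D_def D'_def algebra_simps)
  then have a_iff: "D' - D \<in> ppow v n \<longleftrightarrow> a - a' \<in> ppow v n"
    using unit_mult_iff[of 2 "D' - D" n] unit_mult_iff[of D "D' * (a - a')" n]
      unit_mult_iff[of D' "a - a'" n] D two by (simp add: mult.assoc)
  have "2 * (m * D' - m' * D) = D * D' * (c - c')"
    using nz by (simp add: c field_simps)
  then have c_iff: "m * D' - m' * D \<in> ppow v n \<longleftrightarrow> c - c' \<in> ppow v n"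
    using unit_mult_iff[of 2 "m * D' - m' * D" n] unit_mult_iff[of D "D' * (c - c')" n]
      unit_mult_iff[of D' "c - c'" n] D two by (simp add: mult.assoc)
  have "mat_cong v n (rot \<alpha> m) (rot \<alpha> m') \<longleftrightarrow> a - a' \<in> ppow v n \<and> c - c' \<in> ppow v n"
  proof -
    have "- (\<alpha> * c) - - (\<alpha> * c') = - (\<alpha> * (c - c'))" by (simp add: algebra_simps)
    then have "- (\<alpha> * c) - - (\<alpha> * c') \<in> ppow v n" if "c - c' \<in> ppow v n"
      using ppow_mult_left[OF \<alpha> that] by simp
    then show ?thesis
      unfolding mat_cong_iff rot_entries by (auto simp: a c D_def D'_def)
  qed
  also have "\<dots> \<longleftrightarrow> D' - D \<in> ppow v n \<and> m * D' - m' * D \<in> ppow v n"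
    by (simp add: a_iff c_iff)
  also have "\<dots> \<longleftrightarrow> m - m' \<in> ppow v n"
  proof
    assume *: "D' - D \<in> ppow v n \<and> m * D' - m' * D \<in> ppow v n"
    have "(m * D' - m' * D) - m * (D' - D) \<in> ppow v n"
      using ppow_diff[of "m * D' - m' * D" n "m * (D' - D)"] ppow_mult_left[OF m(1), of "D' - D" n] * by blast
    then have "D * (m - m') \<in> ppow v n" by (simp add: algebra_simps)
    then show "m - m' \<in> ppow v n" using unit_mult_iff D by blast
  next
    assume mm: "m - m' \<in> ppow v n"
    have eq: "D' - D = - (\<alpha> * (m + m') * (m - m'))"
      by (simp add: D_def D'_def algebra_simps power2_eq_square)
    have "\<alpha> * (m + m') * (m - m') \<in> ppow v n"
      using mm m m' \<alpha> by (intro ppow_mult_left ppow_add) auto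
    then have DD: "D' - D \<in> ppow v n" by (simp add: eq)
    moreover have "m * D' - m' * D = m * (D' - D) + D * (m - m')" by (simp add: algebra_simps)
    moreover have "m * (D' - D) + D * (m - m') \<in> ppow v n"
      using DD mm m D by (intro ppow_add ppow_mult_left) auto
    ultimately show "D' - D \<in> ppow v n \<and> m * D' - m' * D \<in> ppow v n" by simp
  qed
  finally show ?thesis .
qed

text \<open>\<open>M\<close> meets the conic equation only up to \<open>w\<close> in \<pp>^n, but
  its slope \<open>m\<close> is an actual element of \<O>. The first columns of
  \<open>rot \<alpha> m\<close> and \<open>M\<close> then differ by multiples of \<open>w\<close>,
  and the second columns follow from the congruences of \<open>so2_iff\<close>.\<close>

lemma so2_eq_rot:
  assumes M: "M \<in> so2 \<alpha> n" and u: "M $ 1 $ 1 + 1 \<notin> ppow v 1" and n: "n \<ge> 1"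
    and m_eq: "m = M $ 2 $ 1 / (M $ 1 $ 1 + 1)"
  shows "m \<in> ppow v 0" "1 + \<alpha> * m\<^sup>2 \<notin> ppow v 1" "mat_cong v n (rot \<alpha> m) M"
proof -
  define a b c d where abcd: "a = M $ 1 $ 1" "b = M $ 1 $ 2" "c = M $ 2 $ 1" "d = M $ 2 $ 2"
  define w where "w = a\<^sup>2 + \<alpha> * c\<^sup>2 - 1"
  \<comment> \<open>\<open>E\<close> is (a + 1)^2 (1 + \<alpha> m^2), see \<open>sq\<close>. It is a
    unit because 2 and a + 1 are units and \<open>n \<ge> 1\<close> puts \<open>w\<close> in
    \<pp>.\<close>
  define E where "E = 2 * (a + 1) + w"
  have int: "a \<in> ppow v 0" "b \<in> ppow v 0" "c \<in> ppow v 0" "d \<in> ppow v 0"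
    and M': "b + \<alpha> * c \<in> ppow v n" "d - a \<in> ppow v n" "w \<in> ppow v n"
    using M by (auto simp: so2_iff[OF \<alpha>] integral_mat_iff abcd w_def)
  have a1: "a + 1 \<in> ppow v 0" "a + 1 \<notin> ppow v 1" using int u by (auto simp: abcd intro: ppow_add)
  then have a1nz: "a + 1 \<noteq> 0" by auto
  have m: "m = c / (a + 1)" by (simp add: m_eq abcd)
  show m0: "m \<in> ppow v 0" using a1 int by (simp add: m unit_divide_iff)
  have w1: "w \<in> ppow v 1" "w \<in> ppow v 0" using M' n by (auto intro: ppow_antimono)
  have "2 * (a + 1) \<notin> ppow v 1" using unit_mult_iff[of 2 "a + 1" 1] a1 two by simp
  then have E1: "E \<notin> ppow v 1" using w1(1) ppow_add_cancel_left[of w 1 "2 * (a + 1)"]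
    by (simp add: E_def add.commute)
  have E0: "E \<in> ppow v 0" unfolding E_def using ppow_add[OF ppow_mult_left[OF _ a1(1), of 2] w1(2)] by simp
  have Enz: "E \<noteq> 0" using E1 by auto
  have sq: "(a + 1)\<^sup>2 * (1 + \<alpha> * m\<^sup>2) = E"
  proof -
    have "(a + 1)\<^sup>2 * (1 + \<alpha> * m\<^sup>2) = (a + 1)\<^sup>2 + \<alpha> * ((a + 1) * m)\<^sup>2"
      by (simp add: algebra_simps power2_eq_square)
    also have "(a + 1) * m = c" using a1nz by (simp add: m)
    finally show ?thesis by (simp add: E_def w_def algebra_simps power2_eq_square)
  qed
  show D: "1 + \<alpha> * m\<^sup>2 \<notin> ppow v 1"
  proof
    assume "1 + \<alpha> * m\<^sup>2 \<in> ppow v 1"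
    then have "(a + 1)\<^sup>2 * (1 + \<alpha> * m\<^sup>2) \<in> ppow v 1"
      using a1 by (intro ppow_mult_left) (auto simp: power2_eq_square intro: ppow_mult_left)
    then show False using sq E1 by simp
  qed
  then have Dnz: "1 + \<alpha> * m\<^sup>2 \<noteq> 0" by auto
  have num: "(a + 1)\<^sup>2 * (1 - \<alpha> * m\<^sup>2) = 2 * a * (a + 1) - w"
  proof -
    have "(a + 1)\<^sup>2 * (1 - \<alpha> * m\<^sup>2) = (a + 1)\<^sup>2 - \<alpha> * ((a + 1) * m)\<^sup>2"
      by (simp add: algebra_simps power2_eq_square)
    also have "(a + 1) * m = c" using a1nz by (simp add: m)
    finally show ?thesis by (simp add: w_def algebra_simps power2_eq_square)
  qed
  define a' c' where "a' = rot \<alpha> m $ 1 $ 1" and "c' = rot \<alpha> m $ 2 $ 1"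
  \<comment> \<open>Expanding by (a + 1)^2 makes \<open>E\<close> the denominator; the difference to
    the entry of \<open>M\<close> is then a multiple of w / E.\<close>
  have "a' = ((a + 1)\<^sup>2 * (1 - \<alpha> * m\<^sup>2)) / ((a + 1)\<^sup>2 * (1 + \<alpha> * m\<^sup>2))"
    using a1nz by (simp add: a'_def rot_entries)
  then have "a' = (2 * a * (a + 1) - w) / E" by (simp only: num sq)
  then have "a' - a = (- w - a * w) / E"
    using Enz by (simp add: field_simps) (simp add: E_def algebra_simps)
  then have a': "a' - a \<in> ppow v n"
    using M' int E0 E1 by (simp add: unit_divide_iff) (auto intro!: ppow_diff ppow_mult_left)
  have "c' = ((a + 1)\<^sup>2 * (2 * m)) / ((a + 1)\<^sup>2 * (1 + \<alpha> * m\<^sup>2))"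
    using a1nz by (simp add: c'_def rot_entries)
  then have "c' = (2 * c * (a + 1)) / E" using a1nz by (simp only: sq) (simp add: m power2_eq_square)
  then have "c' - c = (- (c * w)) / E"
    using Enz by (simp add: field_simps) (simp add: E_def algebra_simps)
  then have c': "c' - c \<in> ppow v n"
    using M' int E0 E1 by (simp add: unit_divide_iff ppow_mult_left)
  have "- (\<alpha> * c') - b = - (\<alpha> * (c' - c) + (b + \<alpha> * c))" by (simp add: algebra_simps)
  then have "- (\<alpha> * c') - b \<in> ppow v n"
    using ppow_add[OF ppow_mult_left[OF \<alpha> c'] M'(1)] by (simp only: ppow_uminus_iff)
  moreover have "a' - d \<in> ppow v n" using ppow_diff[OF a' M'(2)] by simp
  ultimately show "mat_cong v n (rot \<alpha> m) M"
    using a' c' unfolding mat_cong_iff rot_entries(3,4) by (simp add: a'_def c'_def abcd)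
qed

text \<open>On matrices with a + 1 a unit, slopes correspond to classes: \<open>rot_cong_iff\<close>
  gives injectivity and \<open>so2_eq_rot\<close> surjectivity.\<close>

lemma card_mcls_rot:
  assumes n: "n \<ge> 1" and A: "A \<subseteq> so2 \<alpha> n"
    and S: "\<And>m. m \<in> S \<Longrightarrow> m \<in> ppow v 0 \<and> 1 + \<alpha> * m\<^sup>2 \<notin> ppow v 1 \<and> rot \<alpha> m \<in> A"
    and AS: "\<And>M. M \<in> A \<Longrightarrow> M $ 1 $ 1 + 1 \<notin> ppow v 1 \<and> M $ 2 $ 1 / (M $ 1 $ 1 + 1) \<in> S"
  shows "card (mcls n ` A) = card (cls n ` S)"
proof (rule card_image_transport[where f = "rot \<alpha>"])
  show "rot \<alpha> m \<in> A" if "m \<in> S" for m using S that by blast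
  have iR: "integral_mat v (rot \<alpha> m)" if "m \<in> S" for m
    using S[OF that] A so2_integral by blast
  show "mcls n (rot \<alpha> m) = mcls n (rot \<alpha> m') \<longleftrightarrow> cls n m = cls n m'" if "m \<in> S" "m' \<in> S" for m m'
    using S that rot_cong_iff[of m m' n] iR by (simp add: mcls_eq_iff cls_eq_iff)
  show "\<exists>m\<in>S. mcls n (rot \<alpha> m) = mcls n M" if "M \<in> A" for M
  proof
    let ?m = "M $ 2 $ 1 / (M $ 1 $ 1 + 1)"
    show "?m \<in> S" using AS[OF that] by simp
    then show "mcls n (rot \<alpha> ?m) = mcls n M"
      using that A AS[OF that] n so2_eq_rot(3)[of M n ?m] iR so2_integral[of M \<alpha> n]
      by (subst mcls_eq_iff) auto
  qed
qed


subsection \<open>Counting\<close>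

text \<open>With D = 1 + \<alpha> m^2, the matrix \<open>rot \<alpha> m\<close> moves s by the
  vector with coordinates -2 (\<alpha> m \<cdot> m s1 + \<alpha> m s2) / D and 2 (m s1 - m \<cdot>
  \<alpha> m s2) / D, which lie in \<pp>^k for the listed m. Conversely, a fixing matrix has a
  \<equiv> 1 modulo \<pp>, so a + 1 is a unit, and a unit among s1, s2 yields the conditions on its
  slope.\<close>

lemma card_mcls_stabilizer:
  assumes s: "s1 \<in> ppow v 0" "s2 \<in> ppow v 0" "s1 \<notin> ppow v 1 \<or> s2 \<notin> ppow v 1"
    and k: "1 \<le> k" "k \<le> n"
  shows "card (mcls n ` {M \<in> so2 \<alpha> n. M $ 1 $ 1 * s1 + M $ 1 $ 2 * s2 - s1 \<in> ppow v k \<and>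
      M $ 2 $ 1 * s1 + M $ 2 $ 2 * s2 - s2 \<in> ppow v k}) =
    card (cls n ` {m \<in> ppow v 0. m * s1 \<in> ppow v k \<and> \<alpha> * m * s2 \<in> ppow v k})"
    (is "card (mcls n ` ?A) = card (cls n ` ?S)")
proof (rule card_mcls_rot)
  show "?A \<subseteq> so2 \<alpha> n" "n \<ge> 1" using k by auto
  note k1 = ppow_antimono[OF _ k(1)]
  show "m \<in> ppow v 0 \<and> 1 + \<alpha> * m\<^sup>2 \<notin> ppow v 1 \<and> rot \<alpha> m \<in> ?A" if "m \<in> ?S" for m
  proof -
    from that have m: "m \<in> ppow v 0" "m * s1 \<in> ppow v k" "\<alpha> * m * s2 \<in> ppow v k" by auto
    have "s1 * m \<in> ppow v 1" "s2 * (\<alpha> * m) \<in> ppow v 1" using k1 m by (simp_all add: mult.commute)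
    \<comment> \<open>If \<open>s1\<close> is a unit, then \<open>m\<close> lies in \<pp>; otherwise
      \<open>s2\<close> is one and \<alpha> m lies in \<pp>.\<close>
    then have "\<alpha> * m \<in> ppow v 1" using s m \<alpha> by (metis unit_mult_iff ppow_mult_left)
    then have "\<alpha> * m * m \<in> ppow v 1" using m(1) by (rule ppow_mult_right)
    then have am: "\<alpha> * m\<^sup>2 \<in> ppow v 1" by (simp add: power2_eq_square mult.assoc)
    then have D1: "1 + \<alpha> * m\<^sup>2 \<notin> ppow v 1" using ppow_add_cancel_left[OF am, of 1] by (simp add: add.commute)
    define D where "D = 1 + \<alpha> * m\<^sup>2"
    have D: "D \<in> ppow v 0" "D \<notin> ppow v 1" "D \<noteq> 0"
      using D1 ppow_add[OF one_mem_ppow(1) ppow_antimono[OF am, of 0]] by (auto simp: D_def)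
    have "(1 - \<alpha> * m\<^sup>2) / D * s1 + - (\<alpha> * (2 * m / D)) * s2 - s1 =
        - (2 * ((\<alpha> * m) * (m * s1) + \<alpha> * m * s2)) / D"
      using D(3) by (simp add: field_simps) (simp add: D_def algebra_simps power2_eq_square)
    moreover have "2 * ((\<alpha> * m) * (m * s1) + \<alpha> * m * s2) \<in> ppow v k"
      using m \<alpha> by (intro ppow_mult_left[of 2] ppow_add ppow_mult_left[of "\<alpha> * m" "m * s1"])
        (auto intro: ppow_mult_left)
    ultimately have e1: "(1 - \<alpha> * m\<^sup>2) / D * s1 + - (\<alpha> * (2 * m / D)) * s2 - s1 \<in> ppow v k"
      using D by (simp only: unit_divide_iff ppow_uminus_iff simp_thms)
    have "2 * m / D * s1 + (1 - \<alpha> * m\<^sup>2) / D * s2 - s2 = (2 * (m * s1 - m * (\<alpha> * m * s2))) / D"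
      using D(3) by (simp add: field_simps) (simp add: D_def algebra_simps power2_eq_square)
    moreover have "2 * (m * s1 - m * (\<alpha> * m * s2)) \<in> ppow v k"
      using m by (intro ppow_mult_left[of 2] ppow_diff ppow_mult_left[of m "\<alpha> * m * s2"]) auto
    ultimately have "2 * m / D * s1 + (1 - \<alpha> * m\<^sup>2) / D * s2 - s2 \<in> ppow v k"
      using D by (simp only: unit_divide_iff simp_thms)
    then show ?thesis
      using e1 m D1 rot_mem_so2[OF m(1) D1] by (simp add: rot_entries D_def)
  qed
  show "M $ 1 $ 1 + 1 \<notin> ppow v 1 \<and> M $ 2 $ 1 / (M $ 1 $ 1 + 1) \<in> ?S" if M: "M \<in> ?A" for M
  proof -
    define a b c d where abcd: "a = M $ 1 $ 1" "b = M $ 1 $ 2" "c = M $ 2 $ 1" "d = M $ 2 $ 2"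
    define w where "w = a\<^sup>2 + \<alpha> * c\<^sup>2 - 1"
    \<comment> \<open>The coordinates of M s - s after the second column of M has been replaced by
      (-\<alpha> c, a).\<close>
    define E1 E2 where E: "E1 = (a - 1) * s1 - \<alpha> * c * s2" "E2 = c * s1 + (a - 1) * s2"
    have int: "a \<in> ppow v 0" "b \<in> ppow v 0" "c \<in> ppow v 0" "d \<in> ppow v 0"
      and "b + \<alpha> * c \<in> ppow v n" "d - a \<in> ppow v n" "w \<in> ppow v n"
      using M by (auto simp: so2_iff[OF \<alpha>] integral_mat_iff abcd w_def)
    then have M': "b + \<alpha> * c \<in> ppow v k" "d - a \<in> ppow v k" "w \<in> ppow v k"
      using k by (auto intro: ppow_antimono)
    have "a * s1 + b * s2 - s1 - (b + \<alpha> * c) * s2 \<in> ppow v k" "c * s1 + d * s2 - s2 - (d - a) * s2 \<in> ppow v k"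
      using M M' s by (auto simp: abcd[symmetric] intro!: ppow_diff[OF _ ppow_mult_right])
    then have Ek: "E1 \<in> ppow v k" "E2 \<in> ppow v k" by (simp_all add: E algebra_simps)
    have a0: "a - 1 \<in> ppow v 0" using int ppow_diff by auto
    have a1: "a - 1 \<in> ppow v 1"
    proof (cases "s1 \<in> ppow v 1")
      case True
      then have "E2 - c * s1 \<in> ppow v 1" using k1 Ek int by (intro ppow_diff ppow_mult_left) auto
      then have "s2 * (a - 1) \<in> ppow v 1" by (simp add: E algebra_simps)
      then show ?thesis using True s unit_mult_iff by blast
    next
      case False
      text \<open>Eliminating \<open>c\<close> from \<open>w = (a - 1) (a + 1) + \<alpha> c\<^sup>2\<close> by means of \<open>E1\<close> and \<open>E2\<close>.\<close>
      have "s1 * (s1 * (2 * (a - 1))) = s1 * s1 * w - \<alpha> * E2 * E2 + 2 * \<alpha> * (a - 1) * s2 * E2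
          - (a - 1) * (s1 * E1 + \<alpha> * s2 * E2)"
        by (simp add: E w_def algebra_simps power2_eq_square)
      moreover have "s1 * s1 * w \<in> ppow v k" "\<alpha> * E2 * E2 \<in> ppow v k"
          "2 * \<alpha> * (a - 1) * s2 * E2 \<in> ppow v k" "(a - 1) * (s1 * E1 + \<alpha> * s2 * E2) \<in> ppow v k"
        using M'(3) Ek s a0 \<alpha> ppow_antimono[of E2 k 0] k
        by (auto simp: mult.assoc intro!: ppow_mult_left[of s1] ppow_mult_left[of \<alpha>] ppow_mult_left[of 2]
            ppow_mult_left[of s2] ppow_mult_left[of "a - 1"] ppow_add ppow_mult_left[of E2])
      ultimately have "s1 * (s1 * (2 * (a - 1))) \<in> ppow v k" by (simp add: ppow_add ppow_diff)
      then have "s1 * (s1 * (2 * (a - 1))) \<in> ppow v 1" by (rule k1)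
      then have "2 * (a - 1) \<in> ppow v 1" using False s unit_mult_iff by blast
      then show ?thesis using two unit_mult_iff[OF numeral_mem_ppow] by blast
    qed
    have "a - 1 + 2 \<notin> ppow v 1" using ppow_add_cancel_left[OF a1, of 2] two by blast
    moreover have "a - 1 + 2 = a + 1" by simp
    ultimately have ap: "a + 1 \<in> ppow v 0" "a + 1 \<notin> ppow v 1"
      using ppow_add[OF int(1) one_mem_ppow(1)] by simp_all
    then have anz: "a + 1 \<noteq> 0" by auto
    define m where "m = c / (a + 1)"
    have c: "c = (a + 1) * m" using anz by (simp add: m_def)
    have m0: "m \<in> ppow v 0" using ap int by (simp add: m_def unit_divide_iff)
    \<comment> \<open>The factorization w = (a + 1) y gives a - 1 \<equiv> - \<alpha> c m modulo
      \<pp>^k; inserting this in \<open>E1\<close> and \<open>E2\<close> leaves multiples of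
      \<alpha> c and of c.\<close>
    define y where "y = a - 1 + \<alpha> * c * m"
    have "(a + 1) * y = w" by (simp add: y_def w_def c algebra_simps power2_eq_square)
    then have y: "y \<in> ppow v k" using M'(3) ap unit_mult_iff by metis
    have "(m * s1 + s2) * (\<alpha> * c) = y * s1 - E1" "(s1 - \<alpha> * m * s2) * c = E2 - y * s2"
      by (simp_all add: y_def E algebra_simps)
    moreover have "y * s1 - E1 \<in> ppow v k" "E2 - y * s2 \<in> ppow v k"
      using y Ek s by (auto intro!: ppow_diff ppow_mult_right)
    ultimately have F: "(m * s1 + s2) * (\<alpha> * c) \<in> ppow v k" "(s1 - \<alpha> * m * s2) * c \<in> ppow v k"
      by simp_all
    \<comment> \<open>In either case a cofactor in \<open>F\<close> is a unit: m s1 + s2 if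
      \<open>s1\<close> lies in \<pp>, and otherwise s1 - \<alpha> m s2, because then \<alpha> m
      lies in \<pp>.\<close>
    have "c * s1 \<in> ppow v k \<and> \<alpha> * c \<in> ppow v k"
    proof (cases "s1 \<in> ppow v 1")
      case True
      have "m * s1 \<in> ppow v 1" using m0 True by (rule ppow_mult_left)
      then have "m * s1 + s2 \<in> ppow v 0" "m * s1 + s2 \<notin> ppow v 1"
        using ppow_add_cancel_left[of "m * s1" 1 s2] s True m0 by (auto intro: ppow_add ppow_mult_left)
      then have ac: "\<alpha> * c \<in> ppow v k" using F(1) unit_mult_iff by blast
      have "(s1 - \<alpha> * m * s2) * c + m * s2 * (\<alpha> * c) \<in> ppow v k"
        using F(2) ac m0 s by (intro ppow_add ppow_mult_left[of "m * s2"]) (auto intro: ppow_mult_left)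
      then show ?thesis using ac by (simp add: algebra_simps)
    next
      case False
      have "y - (a - 1) \<in> ppow v 1" using k1[OF y] a1 by (rule ppow_diff)
      then have "(a + 1) * ((\<alpha> * m) * m) \<in> ppow v 1" by (simp add: y_def c algebra_simps)
      then have "(\<alpha> * m) * m \<in> ppow v 1" using ap by (simp add: unit_mult_iff)
      then have "\<alpha> * m \<in> ppow v 1" using prime_ideal[of "\<alpha> * m" m] m0 \<alpha> by (auto intro: ppow_mult_left)
      then have "\<alpha> * m * s2 \<in> ppow v 1" using s by (auto intro: ppow_mult_right)
      then have "s1 - \<alpha> * m * s2 \<in> ppow v 0" "s1 - \<alpha> * m * s2 \<notin> ppow v 1"
        using ppow_add_cancel_left[of "- (\<alpha> * m * s2)" 1 s1] s False
          ppow_antimono[of "\<alpha> * m * s2" 1 0] by (auto intro: ppow_diff)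
      then have "c \<in> ppow v k" using F(2) unit_mult_iff by blast
      then show ?thesis using s \<alpha> by (auto intro: ppow_mult_left ppow_mult_right)
    qed
    then have "(a + 1) * (m * s1) \<in> ppow v k" "(a + 1) * (\<alpha> * m) \<in> ppow v k"
      by (simp_all add: c algebra_simps)
    then have "m * s1 \<in> ppow v k" "\<alpha> * m \<in> ppow v k" using ap by (simp_all add: unit_mult_iff)
    moreover from this(2) have "\<alpha> * m * s2 \<in> ppow v k" using s(2) by (rule ppow_mult_right)
    ultimately have "m \<in> ?S" using m0 by blast
    then show ?thesis using ap(2) unfolding m_def abcd by blast
  qed
qed

text \<open>Let Q = s1^2 + \<alpha> s2^2. Given m s1 in \<pp>^k, the condition on \<alpha> m s2 is
  equivalent to m Q in \<pp>^k: if \<open>s1\<close> lies in \<pp>, then s2 is a unit and m Q = s1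
  (m s1) + s2 (\<alpha> m s2); if \<open>s1\<close> is a unit, m lies in \<pp>^k and both hold. What
  remains are lower bounds for \<open>v m\<close>.\<close>

lemma ppow_eq_stabilizer_ideal:
  assumes s: "s1 \<in> ppow v 0" "s2 \<in> ppow v 0" "s1 \<notin> ppow v 1 \<or> s2 \<notin> ppow v 1" and k: "0 \<le> k"
  obtains j where "0 \<le> j" "j \<le> k"
    "min (ereal (real_of_int k)) (min (ordp v (s1\<^sup>2 + \<alpha> * s2\<^sup>2)) (ordp v s1)) = ereal (real_of_int j)"
    "{m \<in> ppow v 0. m * s1 \<in> ppow v k \<and> \<alpha> * m * s2 \<in> ppow v k} = ppow v (k - j)"
proof -
  define Q where "Q = s1\<^sup>2 + \<alpha> * s2\<^sup>2"
  \<comment> \<open>At a zero argument \<open>k\<close> stands in for the value \<infinity>, which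
    the minimum with \<open>k\<close> would reduce to \<open>k\<close> anyway.\<close>
  define j where "j = min k (min (if Q = 0 then k else v Q) (if s1 = 0 then k else v s1))"
  have Q0: "Q \<in> ppow v 0" unfolding Q_def power2_eq_square using s \<alpha> by (auto intro!: ppow_add ppow_mult_left)
  have min: "min (ereal (real_of_int k)) (min (ordp v Q) (ordp v s1)) = ereal (real_of_int j)"
    by (auto simp: j_def ordp_def min_def)
  have "m \<in> ppow v (k - j) \<longleftrightarrow> m \<in> ppow v 0 \<and> m * s1 \<in> ppow v k \<and> m * Q \<in> ppow v k" for m
  proof (cases "m = 0")
    case False
    then have "m * x \<in> ppow v k \<longleftrightarrow> x = 0 \<or> k \<le> v m + v x" for x
      by (cases "x = 0") (use False v_mult[of m x] in \<open>auto simp: mem_ppow_iff\<close>)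
    moreover have "k - j \<le> v m \<longleftrightarrow>
        0 \<le> v m \<and> (s1 = 0 \<or> k \<le> v m + v s1) \<and> (Q = 0 \<or> k \<le> v m + v Q)"
      by (cases "Q = 0"; cases "s1 = 0"; simp add: j_def; linarith)
    ultimately show ?thesis using False by (simp add: mem_ppow_iff)
  qed simp
  moreover have "m * Q \<in> ppow v k \<longleftrightarrow> \<alpha> * m * s2 \<in> ppow v k"
    if m: "m \<in> ppow v 0" "m * s1 \<in> ppow v k" for m
  proof (cases "s1 \<in> ppow v 1")
    case True
    have "m * Q = s1 * (m * s1) + s2 * (\<alpha> * m * s2)" by (simp add: Q_def algebra_simps power2_eq_square)
    moreover have "s1 * (m * s1) \<in> ppow v k" using s m by (intro ppow_mult_left[of s1 "m * s1"])
    ultimately show ?thesis using ppow_add_cancel_left s True unit_mult_iff by metis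
  next
    case False
    then have mk: "m \<in> ppow v k" using m s unit_mult_iff[of s1 m k] by (simp add: mult.commute)
    then show ?thesis using Q0 \<alpha> s by (auto intro: ppow_mult_left ppow_mult_right)
  qed
  ultimately have "{m \<in> ppow v 0. m * s1 \<in> ppow v k \<and> \<alpha> * m * s2 \<in> ppow v k} = ppow v (k - j)"
    by blast
  moreover have "0 \<le> j" "j \<le> k" using Q0 s k by (auto simp: j_def mem_ppow_iff)
  ultimately show ?thesis using that min by (simp add: Q_def)
qed

section \<open>Order of the special orthogonal group\<close>

text \<open>The first set holds the slopes with a + 1 a unit, the second those with a \<equiv> 1
  modulo \<pp>. With q = \<open>residue_norm v\<close> the sum is 2 q^t if \<alpha> lies in \<pp>;
  for a unit \<alpha> it is q^t + q^(t-1) if -\<alpha> is not a square modulo \<pp>, and (q^t - 2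
  q^(t-1)) + q^(t-1) if it is.\<close>

lemma card_cls_parameters:
  assumes t: "t \<ge> 1"
  shows "real (card (cls (int t) ` {m \<in> ppow v 0. 1 + \<alpha> * m\<^sup>2 \<notin> ppow v 1})) +
      real (card (cls (int t) ` {m \<in> ppow v 0. \<alpha> * m \<in> ppow v 1})) =
    real (residue_norm v) ^ t * (1 - eta v (- \<alpha>) / real (residue_norm v))"
    (is "real (card (_ ` ?S)) + real (card (_ ` ?T)) = _")
proof -
  let ?q = "real (residue_norm v)"
  have q: "?q > 0" using residue_norm_pos by simp
  have qt: "?q ^ t = ?q * ?q ^ (t - 1)" using t by (metis power_eq_if not_one_le_zero)
  have sq_mem: "\<alpha> * m\<^sup>2 \<in> ppow v 1 \<longleftrightarrow> \<alpha> * m \<in> ppow v 1" if "m \<in> ppow v 0" for m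
    using that \<alpha> by (simp add: power2_eq_square prime_ideal ppow_mult_left)
  show ?thesis
  proof (cases "\<alpha> \<in> ppow v 1")
    case True
    have "?T = ppow v 0" using True by (auto intro: ppow_mult_right)
    moreover have "?S = ppow v 0"
    proof -
      have "1 + \<alpha> * m\<^sup>2 \<notin> ppow v 1" if m: "m \<in> ppow v 0" for m
      proof -
        have "\<alpha> * m\<^sup>2 \<in> ppow v 1" using sq_mem[OF m] ppow_mult_right[OF True m] by simp
        then show ?thesis using ppow_add_cancel_left[of "\<alpha> * m\<^sup>2" 1 1] by (simp add: add.commute)
      qed
      then show ?thesis by auto
    qed
    moreover have "eta v (- \<alpha>) = - ?q" using True by (simp add: eta_def max_ideal_eq)
    ultimately show ?thesis using q by (simp add: card_cls_integers)
  next
    case False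
    have "?T = {m. m - 0 \<in> ppow v 1}"
      using False \<alpha> by (auto simp: prime_ideal intro: ppow_antimono ppow_mult_left)
    then have T: "card (cls (int t) ` ?T) = residue_norm v ^ (t - 1)"
      using card_cls_residue_class[OF t, of 0] by simp
    show ?thesis
    proof (cases "\<exists>y\<in>ppow v 0. - \<alpha> - y\<^sup>2 \<in> ppow v 1")
      case nonsquare: False
      \<comment> \<open>A zero \<open>m\<close> would be a unit and make -\<alpha> congruent to the
        square of 1/m.\<close>
      have "1 + \<alpha> * m\<^sup>2 \<notin> ppow v 1" if m: "m \<in> ppow v 0" for m
      proof
        assume *: "1 + \<alpha> * m\<^sup>2 \<in> ppow v 1"
        have m1: "m \<notin> ppow v 1"
        proof
          assume "m \<in> ppow v 1"
          then have "\<alpha> * m\<^sup>2 \<in> ppow v 1" using sq_mem m \<alpha> ppow_mult_left by blast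
          then show False using * ppow_add_cancel_left[of "\<alpha> * m\<^sup>2" 1 1] by (simp add: add.commute)
        qed
        then have "m \<noteq> 0" by auto
        then have "- \<alpha> - (inverse m)\<^sup>2 = - ((1 + \<alpha> * m\<^sup>2) * (inverse m * inverse m))"
          by (simp add: field_simps power2_eq_square)
        moreover have "(1 + \<alpha> * m\<^sup>2) * (inverse m * inverse m) \<in> ppow v 1"
          using * unit_inverse[OF m m1] by (intro ppow_mult_right[of _ 1 "_ * _"]) (auto intro: ppow_mult_left)
        ultimately show False using nonsquare unit_inverse[OF m m1] by (metis ppow_uminus_iff)
      qed
      then have "?S = ppow v 0" by auto
      moreover have "eta v (- \<alpha>) = - 1"
        using False nonsquare by (simp add: eta_def max_ideal_eq integers_eq)
      ultimately show ?thesis using q T by (simp add: card_cls_integers qt field_simps)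
    next
      case True
      then obtain y where y: "y \<in> ppow v 0" "- \<alpha> - y\<^sup>2 \<in> ppow v 1" by blast
      have y1: "y \<notin> ppow v 1"
      proof
        assume "y \<in> ppow v 1"
        then have "y\<^sup>2 \<in> ppow v 1" using y by (simp add: power2_eq_square ppow_mult_left)
        then show False using ppow_add[OF y(2), of "y\<^sup>2"] False by simp
      qed
      \<comment> \<open>Modulo \<pp>, 1 + \<alpha> m^2 \<equiv> 1 - y^2 m^2 = - y^2 (m - z) (m + z),
        so the zeros are the classes of z and -z.\<close>
      define z where "z = inverse y"
      have z: "z \<in> ppow v 0" "z \<notin> ppow v 1" "y * z = 1"
        using unit_inverse[OF y(1) y1] y1 by (auto simp: z_def intro!: right_inverse)
      define P N where "P = {m. m - z \<in> ppow v 1}" and "N = {m. m - (- z) \<in> ppow v 1}"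
      have PN0: "P \<subseteq> ppow v 0" "N \<subseteq> ppow v 0"
        using z ppow_antimono[of _ 1 0] ppow_add[of _ 0 z] ppow_add[of _ 0 "- z"]
        by (force simp: P_def N_def)+
      have root_iff: "1 + \<alpha> * m\<^sup>2 \<in> ppow v 1 \<longleftrightarrow> m \<in> P \<union> N" if m: "m \<in> ppow v 0" for m
      proof -
        have eq: "1 + \<alpha> * m\<^sup>2 = - ((- \<alpha> - y\<^sup>2) * m\<^sup>2) + - (y * (y * ((m - z) * (m - - z))))"
        proof -
          have "y * (y * ((m - z) * (m - - z))) = y\<^sup>2 * m\<^sup>2 - (y * z)\<^sup>2"
            by (simp add: algebra_simps power2_eq_square)
          then show ?thesis using z by (simp add: algebra_simps)
        qed
        have "(- \<alpha> - y\<^sup>2) * m\<^sup>2 \<in> ppow v 1"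
          using y m by (intro ppow_mult_right[of _ 1 "m\<^sup>2"]) (auto simp: power2_eq_square intro: ppow_mult_left)
        then have "1 + \<alpha> * m\<^sup>2 \<in> ppow v 1 \<longleftrightarrow> - (y * (y * ((m - z) * (m - - z)))) \<in> ppow v 1"
          unfolding eq by (intro ppow_add_cancel_left) simp
        also have "\<dots> \<longleftrightarrow> (m - z) * (m - - z) \<in> ppow v 1"
          using y y1 by (simp only: ppow_uminus_iff unit_mult_iff simp_thms)
        also have "\<dots> \<longleftrightarrow> m - z \<in> ppow v 1 \<or> m - - z \<in> ppow v 1"
          using m z by (intro prime_ideal) (auto intro: ppow_diff ppow_add)
        finally show ?thesis by (simp add: P_def N_def)
      qed
      have "card (cls (int t) ` (P \<union> N)) = card (cls (int t) ` P) + card (cls (int t) ` N)"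
      proof (rule card_cls_Un[OF t PN0])
        fix x x' assume "x \<in> P" "x' \<in> N"
        show "x - x' \<notin> ppow v 1"
        proof
          assume "x - x' \<in> ppow v 1"
          \<comment> \<open>This combination is 2 z, a unit since 2 is one; hence the two zeros are
            distinct.\<close>
          then have "(x - x') - (x - z) + (x' - - z) \<in> ppow v 1"
            using \<open>x \<in> P\<close> \<open>x' \<in> N\<close> by (intro ppow_add[of "x - x' - (x - z)"] ppow_diff[of "x - x'"]) (auto simp: P_def N_def)
          then have "2 * z \<in> ppow v 1" by simp
          then show False using z two unit_mult_iff[of 2 z 1] by simp
        qed
      qed
      then have card_PN: "card (cls (int t) ` (P \<union> N)) = 2 * residue_norm v ^ (t - 1)"
        using card_cls_residue_class[OF t, of z] card_cls_residue_class[OF t, of "- z"]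
        by (simp add: P_def N_def)
      have "ppow v 0 = ?S \<union> (P \<union> N)" using root_iff PN0 by blast
      moreover have "card (cls (int t) ` (?S \<union> (P \<union> N))) = card (cls (int t) ` ?S) + card (cls (int t) ` (P \<union> N))"
      proof (rule card_cls_Un[OF t])
        fix x x' assume x: "x \<in> ?S" "x' \<in> P \<union> N"
        show "x - x' \<notin> ppow v 1"
        proof
          assume *: "x - x' \<in> ppow v 1"
          from x(2) have "x \<in> P \<union> N"
            using ppow_add[OF *, of "x' - z"] ppow_add[OF *, of "x' - - z"] by (auto simp: P_def N_def)
          then show False using root_iff x(1) by blast
        qed
      qed (use PN0 in auto)
      ultimately have S: "residue_norm v ^ t = card (cls (int t) ` ?S) + 2 * residue_norm v ^ (t - 1)"
        using card_cls_integers[of t] card_PN by simp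
      have "real (card (cls (int t) ` ?S)) = ?q ^ t - 2 * ?q ^ (t - 1)"
        using arg_cong[OF S, of real] by simp
      moreover have "eta v (- \<alpha>) = 1"
        using False True by (simp add: eta_def max_ideal_eq integers_eq)
      moreover have "?q ^ t * (1 - 1 / ?q) = ?q ^ t - ?q ^ (t - 1)"
        using q by (simp add: qt right_diff_distrib)
      ultimately show ?thesis using T by simp
    qed
  qed
qed

lemma so2_uminus: "M \<in> so2 \<alpha> n \<Longrightarrow> - M \<in> so2 \<alpha> n"
proof -
  have "- x + \<alpha> * - y = - (x + \<alpha> * y)" "- x - - y = - (x - y)" for x y :: 'k by simp_all
  then show "M \<in> so2 \<alpha> n \<Longrightarrow> - M \<in> so2 \<alpha> n"
    unfolding so2_iff[OF \<alpha>] integral_mat_iff uminus_vec_def vec_lambda_beta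
    by (simp only: ppow_uminus_iff power2_minus simp_thms)
qed

text \<open>Classes with a + 1 a unit (\<open>A\<close>) are parametrized by \<open>S\<close>. The
  others (\<open>B\<close>) have a \<equiv> -1 modulo \<pp>; negation turns them into
  \<open>C\<close>, where a + 1 \<equiv> 2 is again a unit and the slopes form
  \<open>T\<close>.\<close>

lemma card_mcls_so2:
  assumes t: "t \<ge> 1"
  shows "real (card (mcls (int t) ` so2 \<alpha> (int t))) =
    real (residue_norm v) ^ t * (1 - eta v (- \<alpha>) / real (residue_norm v))"
proof -
  let ?n = "int t"
  have n: "?n \<ge> 1" using t by simp
  define A B C where "A = {M \<in> so2 \<alpha> ?n. M $ 1 $ 1 + 1 \<notin> ppow v 1}"
    and "B = {M \<in> so2 \<alpha> ?n. M $ 1 $ 1 + 1 \<in> ppow v 1}"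
    and "C = {M \<in> so2 \<alpha> ?n. M $ 1 $ 1 - 1 \<in> ppow v 1}"
  define S T where "S = {m \<in> ppow v 0. 1 + \<alpha> * m\<^sup>2 \<notin> ppow v 1}"
    and "T = {m \<in> ppow v 0. \<alpha> * m \<in> ppow v 1}"
  have TS: "T \<subseteq> S"
  proof
    fix m assume "m \<in> T"
    then have "m \<in> ppow v 0" "m * (\<alpha> * m) \<in> ppow v 1" by (auto simp: T_def intro: ppow_mult_left)
    then show "m \<in> S" using ppow_add_cancel_left[of "\<alpha> * m\<^sup>2" 1 1]
      by (simp add: S_def power2_eq_square add.commute mult.left_commute)
  qed
  have A: "card (mcls ?n ` A) = card (cls ?n ` S)"
  proof (rule card_mcls_rot[OF n])
    show "A \<subseteq> so2 \<alpha> ?n" by (auto simp: A_def)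
    show "M $ 1 $ 1 + 1 \<notin> ppow v 1 \<and> M $ 2 $ 1 / (M $ 1 $ 1 + 1) \<in> S" if "M \<in> A" for M
      using that so2_eq_rot(1,2)[OF _ _ n refl, of M] by (simp add: A_def S_def)
    show "m \<in> ppow v 0 \<and> 1 + \<alpha> * m\<^sup>2 \<notin> ppow v 1 \<and> rot \<alpha> m \<in> A" if "m \<in> S" for m
    proof -
      from that have m: "m \<in> ppow v 0" "1 + \<alpha> * m\<^sup>2 \<notin> ppow v 1" by (auto simp: S_def)
      then have "1 + \<alpha> * m\<^sup>2 \<noteq> 0" by auto
      then have "rot \<alpha> m $ 1 $ 1 + 1 = 2 / (1 + \<alpha> * m\<^sup>2)" by (simp add: rot_entries field_simps)
      moreover have "1 + \<alpha> * m\<^sup>2 \<in> ppow v 0"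
        using m \<alpha> by (auto simp: power2_eq_square intro!: ppow_add ppow_mult_left)
      ultimately show ?thesis
        using m two rot_mem_so2 by (simp add: A_def unit_divide_iff)
    qed
  qed
  have C: "card (mcls ?n ` C) = card (cls ?n ` T)"
  proof (rule card_mcls_rot[OF n])
    show "C \<subseteq> so2 \<alpha> ?n" by (auto simp: C_def)
    show "m \<in> ppow v 0 \<and> 1 + \<alpha> * m\<^sup>2 \<notin> ppow v 1 \<and> rot \<alpha> m \<in> C" if "m \<in> T" for m
    proof -
      from that TS have m: "m \<in> ppow v 0" "1 + \<alpha> * m\<^sup>2 \<notin> ppow v 1" "\<alpha> * m \<in> ppow v 1"
        by (auto simp: S_def T_def)
      then have "1 + \<alpha> * m\<^sup>2 \<noteq> 0" by auto
      then have "rot \<alpha> m $ 1 $ 1 - 1 = - (2 * (m * (\<alpha> * m)) / (1 + \<alpha> * m\<^sup>2))"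
        by (simp add: rot_entries field_simps power2_eq_square)
      moreover have "1 + \<alpha> * m\<^sup>2 \<in> ppow v 0"
        using m \<alpha> by (auto simp: power2_eq_square intro!: ppow_add ppow_mult_left)
      moreover have "2 * (m * (\<alpha> * m)) \<in> ppow v 1"
        using m by (intro ppow_mult_left[of 2] ppow_mult_left[of m]) auto
      ultimately show ?thesis
        using m rot_mem_so2 by (simp add: C_def unit_divide_iff)
    qed
    show "M $ 1 $ 1 + 1 \<notin> ppow v 1 \<and> M $ 2 $ 1 / (M $ 1 $ 1 + 1) \<in> T" if M: "M \<in> C" for M
    proof -
      define a c where ac: "a = M $ 1 $ 1" "c = M $ 2 $ 1"
      have Ms: "M \<in> so2 \<alpha> ?n" and a1: "a - 1 \<in> ppow v 1" using M by (auto simp: C_def ac)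
      have int: "a \<in> ppow v 0" "c \<in> ppow v 0" "a\<^sup>2 + \<alpha> * c\<^sup>2 - 1 \<in> ppow v 1"
        using Ms n by (auto simp: so2_iff[OF \<alpha>] integral_mat_iff ac intro: ppow_antimono)
      have "a - 1 + 2 \<notin> ppow v 1" using ppow_add_cancel_left[OF a1, of 2] two by blast
      moreover have "a - 1 + 2 = a + 1" by simp
      ultimately have ap: "a + 1 \<in> ppow v 0" "a + 1 \<notin> ppow v 1"
        using ppow_add[OF int(1) one_mem_ppow(1)] by simp_all
      \<comment> \<open>The left side is \<alpha> c^2, so primality of \<pp> puts \<alpha> c in
        \<pp>.\<close>
      have "(a\<^sup>2 + \<alpha> * c\<^sup>2 - 1) - (a + 1) * (a - 1) \<in> ppow v 1"
        using int(3) ppow_mult_left[OF ap(1) a1] by (rule ppow_diff)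
      then have "(\<alpha> * c) * c \<in> ppow v 1" by (simp add: algebra_simps power2_eq_square)
      then have "\<alpha> * c \<in> ppow v 1" using prime_ideal[of "\<alpha> * c" c] int \<alpha> by (auto intro: ppow_mult_left)
      then have "\<alpha> * (c / (a + 1)) \<in> ppow v 1" using ap unit_divide_iff[of "a + 1" "\<alpha> * c" 1] by simp
      then show ?thesis using ap int by (simp add: T_def ac[symmetric] unit_divide_iff)
    qed
  qed
  have B: "card (mcls ?n ` B) = card (mcls ?n ` C)"
  proof (rule card_image_transport[where f = uminus])
    show "- M \<in> B" if "M \<in> C" for M
      using that so2_uminus ppow_diff_commute[of 1 "M $ 1 $ 1" 1] by (simp add: B_def C_def)
    show "mcls ?n (- M) = mcls ?n (- N) \<longleftrightarrow> mcls ?n M = mcls ?n N" if "M \<in> C" "N \<in> C" for M N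
    proof -
      have "M \<in> so2 \<alpha> ?n" "N \<in> so2 \<alpha> ?n" using that by (auto simp: C_def)
      then have "integral_mat v M" "integral_mat v N" "integral_mat v (- M)" "integral_mat v (- N)"
        using so2_uminus so2_integral by blast+
      then show ?thesis by (simp add: mcls_eq_iff mat_cong_def ppow_diff_commute)
    qed
    show "\<exists>N\<in>C. mcls ?n (- N) = mcls ?n M" if "M \<in> B" for M
    proof (rule bexI[of _ "- M"])
      have "- (M $ 1 $ 1) - 1 = - (M $ 1 $ 1 + 1)" by simp
      then have "- (M $ 1 $ 1) - 1 \<in> ppow v 1" using that by (simp only: B_def ppow_uminus_iff) simp
      then show "- M \<in> C" using that so2_uminus by (simp add: B_def C_def)
    qed simp
  qed
  \<comment> \<open>The parameter sets have positive finite cardinality; through the equalities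
    \<open>A\<close>, \<open>B\<close> and \<open>C\<close> this forces the sets of matrix classes
    to be finite.\<close>
  have pos: "finite (cls ?n ` U) \<and> card (cls ?n ` U) > 0" if "U \<subseteq> ppow v 0" "0 \<in> U" for U
    using finite_subset[OF image_mono[OF that(1)] finite_cls_integers] that(2)
    by (auto simp: card_gt_0_iff)
  have "0 \<in> S" "0 \<in> T" "S \<subseteq> ppow v 0" "T \<subseteq> ppow v 0" by (auto simp: S_def T_def)
  then have "finite (mcls ?n ` A)" "finite (mcls ?n ` B)"
    using pos A B C by (metis card_ge_0_finite)+
  moreover have "mcls ?n ` A \<inter> mcls ?n ` B = {}"
  proof (rule ccontr)
    assume "mcls ?n ` A \<inter> mcls ?n ` B \<noteq> {}"
    then obtain M N where MN: "M \<in> A" "N \<in> B" "mcls ?n M = mcls ?n N" by auto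
    moreover have "integral_mat v M" "integral_mat v N"
      using MN so2_integral by (auto simp: A_def B_def)
    ultimately have "M $ 1 $ 1 - N $ 1 $ 1 \<in> ppow v ?n" by (simp add: mcls_eq_iff mat_cong_def)
    then have "M $ 1 $ 1 - N $ 1 $ 1 \<in> ppow v 1" using n ppow_antimono by blast
    then show False using MN ppow_add[of "M $ 1 $ 1 - N $ 1 $ 1" 1 "N $ 1 $ 1 + 1"]
      by (simp add: A_def B_def)
  qed
  moreover have "so2 \<alpha> ?n = A \<union> B" by (auto simp: A_def B_def)
  ultimately have "card (mcls ?n ` so2 \<alpha> ?n) = card (cls ?n ` S) + card (cls ?n ` T)"
    using A B C by (simp add: image_Un card_Un_disjoint)
  then show ?thesis using card_cls_parameters[OF t] by (simp add: S_def T_def)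
qed

section \<open>Densities at level t and their limit\<close>

text \<open>Since 2 is a unit, \<open>v 2\<close> is 0 and the congruences modulo \<pp>^(t+e) are
  congruences modulo \<pp>^t.\<close>

lemma O_plus_eq:
  "O_plus v (vector [vector [1, 0], vector [0, \<alpha>]]) tm s t =
    mcls (int t) ` {M \<in> so2 \<alpha> (int t).
      M $ 1 $ 1 * s $ 1 + M $ 1 $ 2 * s $ 2 - s $ 1 \<in> ppow v tm \<and>
      M $ 2 $ 1 * s $ 1 + M $ 2 $ 2 * s $ 2 - s $ 2 \<in> ppow v tm}"
proof -
  have "(2::'k) \<in> ppow v 0" by simp
  then have "v 2 = 0" using two by (simp add: mem_ppow_iff)
  moreover have "M \<in> GL2_lifts v t" if "M \<in> so2 \<alpha> (int t)" for M
    using that by (auto simp: so2_def GL2_lifts_def integers_eq intro!: bexI[of _ 1])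
  ultimately have "{M \<in> GL2_lifts v t.
        mat_cong v (int t + v 2) (transpose M ** vector [vector [1, 0], vector [0, \<alpha>]] ** M)
          (vector [vector [1, 0], vector [0, \<alpha>]]) \<and>
        det M - 1 \<in> ppow v (int t + v 2) \<and> (\<forall>i. (M *v s) $ i - s $ i \<in> ppow v tm)} =
      {M \<in> so2 \<alpha> (int t).
        M $ 1 $ 1 * s $ 1 + M $ 1 $ 2 * s $ 2 - s $ 1 \<in> ppow v tm \<and>
        M $ 2 $ 1 * s $ 1 + M $ 2 $ 2 * s $ 2 - s $ 2 \<in> ppow v tm}"
    by (auto simp: so2_def GL2_lifts_def forall_2 matrix_vector_mult_def sum_2)
  then show ?thesis unfolding O_plus_def quotient_def by (auto simp: mcls_def)
qed

text \<open>Modulo \<pp>^0 = \<O> every integral matrix fixes the coset, so the full group is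
  counted.\<close>

lemma density_seq_zero:
  assumes s: "\<And>i. s $ i \<in> ppow v 0" and t: "t \<ge> 1"
  shows "density_seq v (vector [vector [1, 0], vector [0, \<alpha>]]) 0 s t =
    1 - eta v (- \<alpha>) / real (residue_norm v)"
proof -
  have "{M \<in> so2 \<alpha> (int t).
      M $ 1 $ 1 * s $ 1 + M $ 1 $ 2 * s $ 2 - s $ 1 \<in> ppow v 0 \<and>
      M $ 2 $ 1 * s $ 1 + M $ 2 $ 2 * s $ 2 - s $ 2 \<in> ppow v 0} = so2 \<alpha> (int t)"
    using s so2_integral
    by (auto simp: integral_mat_iff intro!: ppow_diff ppow_add ppow_mult_left)
  then show ?thesis using card_mcls_so2[OF t] residue_norm_pos by (simp add: density_seq_def O_plus_eq)
qed

text \<open>The stabilizer corresponds to the slopes in \<pp>^n with n = tm - j. They form q^(t-n)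
  classes modulo \<pp>^t, with q = \<open>residue_norm v\<close>, so normalization gives q^(-n)
  independently of \<open>t\<close>.\<close>

lemma density_seq_pos:
  assumes s: "\<And>i. s $ i \<in> ppow v 0" "s $ 1 \<notin> ppow v 1 \<or> s $ 2 \<notin> ppow v 1"
    and tm: "1 \<le> tm" "tm \<le> int t"
  shows "density_seq v (vector [vector [1, 0], vector [0, \<alpha>]]) tm s t =
    real (residue_norm v) powr (- real_of_int tm + real_of_ereal (min (ereal (real_of_int tm))
      (min (ordp v ((s $ 1)\<^sup>2 + \<alpha> * (s $ 2)\<^sup>2)) (ordp v (s $ 1)))))"
proof -
  let ?q = "real (residue_norm v)"
  have q: "?q > 0" using residue_norm_pos by simp
  have tm0: "0 \<le> tm" using tm by simp
  obtain j where j: "0 \<le> j" "j \<le> tm"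
    "min (ereal (real_of_int tm)) (min (ordp v ((s $ 1)\<^sup>2 + \<alpha> * (s $ 2)\<^sup>2)) (ordp v (s $ 1))) = ereal (real_of_int j)"
    "{m \<in> ppow v 0. m * s $ 1 \<in> ppow v tm \<and> \<alpha> * m * s $ 2 \<in> ppow v tm} = ppow v (tm - j)"
    by (rule ppow_eq_stabilizer_ideal[OF s(1) s(1) s(2) tm0])
  define n where "n = nat (tm - j)"
  have n: "tm - j = int n" "n \<le> t" using j tm by (auto simp: n_def)
  have "card (O_plus v (vector [vector [1, 0], vector [0, \<alpha>]]) tm s t) = card (cls (int t) ` ppow v (int n))"
    using card_mcls_stabilizer[OF s(1) s(1) s(2) tm] by (simp add: O_plus_eq j(4) n)
  also have "\<dots> = residue_norm v ^ (t - n)" using card_cls_coset[OF n(2), of 0] by simp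
  finally have "density_seq v (vector [vector [1, 0], vector [0, \<alpha>]]) tm s t = ?q ^ (t - n) / ?q ^ t"
    by (simp add: density_seq_def)
  also have "\<dots> = inverse (?q ^ n)" using n(2) q by (simp add: power_diff field_simps)
  also have "\<dots> = ?q powr (- real n)" using q by (simp add: powr_minus powr_realpow)
  also have "- real n = - real_of_int tm + real_of_int j" using n(1) by (metis add.commute minus_diff_eq
      of_int_diff of_int_of_nat_eq uminus_add_conv_diff)
  finally show ?thesis by (simp add: j(3))
qed

end

end

text \<open>\<open>lim\<close> is informative only for convergent sequences, so convergence is
  recorded along with the value.\<close>

lemma convergent_lim_eventually_const:
  fixes f :: "nat \<Rightarrow> real"
  assumes "\<And>n. n \<ge> N \<Longrightarrow> f n = c"
  shows "convergent f \<and> lim f = c"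
proof -
  have "f \<longlonglongrightarrow> c"
    using assms by (intro tendsto_eventually) (auto simp: eventually_sequentially)
  then show ?thesis by (auto simp: convergent_def intro: limI)
qed

theorem theorem3p3:
  fixes p :: nat and Qp :: "'k::field_char_0 set" and v :: "'k \<Rightarrow> int"
    and scale :: "'k \<Rightarrow> 'a::ab_group_add \<Rightarrow> 'a" and b :: "'a \<Rightarrow> 'a \<Rightarrow> 'k"
    and e :: "2 \<Rightarrow> 'a" and L X :: "'a set" and \<nu> :: 'a
    and \<pi> \<alpha> :: 'k and tm :: int and s :: "'k^2"
  assumes "lattice_coset p Qp v scale b e L \<pi> tm s \<nu> X"
    and "2 \<notin> max_ideal v"
    and "\<alpha> \<in> integers_of v"
    and "gram b e = vector [vector [1, 0], vector [0, \<alpha>]]"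
  shows "(tm = 0 \<longrightarrow>
            convergent (density_seq v (gram b e) tm s) \<and>
            beta_plus v (gram b e) tm s = 1 - eta v (- \<alpha>) / real (residue_norm v)) \<and>
         (tm \<ge> 1 \<longrightarrow>
            convergent (density_seq v (gram b e) tm s) \<and>
            beta_plus v (gram b e) tm s =
              real (residue_norm v) powr
                (- real_of_int tm
                 + real_of_ereal (min (ereal (real_of_int tm))
                     (min (ordp v ((s $ 1)\<^sup>2 + \<alpha> * (s $ 2)\<^sup>2)) (ordp v (s $ 1))))))"
proof -
  interpret lattice_coset p Qp v scale b e L \<pi> tm s \<nu> X by fact
  have two: "2 \<notin> ppow v 1" and \<alpha>: "\<alpha> \<in> ppow v 0"
    using assms by (auto simp: max_ideal_eq integers_eq)
  have s: "\<And>i. s $ i \<in> ppow v 0" using s_integral by (simp add: integers_eq)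
  have "\<exists>i. s $ i \<notin> ppow v 1" using s_unit by (metis ereal_less_eq(3) max_ideal_eq max_ideal_def mem_Collect_eq less_irrefl)
  then have su: "s $ 1 \<notin> ppow v 1 \<or> s $ 2 \<notin> ppow v 1" by (metis exhaust_2)
  show ?thesis
  proof (intro conjI impI)
    assume tm: "tm = 0"
    have "convergent (density_seq v (gram b e) 0 s) \<and>
        lim (density_seq v (gram b e) 0 s) = 1 - eta v (- \<alpha>) / real (residue_norm v)"
      unfolding assms(4) by (rule convergent_lim_eventually_const[of 1]) (rule density_seq_zero[OF two \<alpha> s])
    then show "convergent (density_seq v (gram b e) tm s)"
      "beta_plus v (gram b e) tm s = 1 - eta v (- \<alpha>) / real (residue_norm v)"
      by (simp_all add: beta_plus_def tm)
  next
    assume tm: "tm \<ge> 1"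
    \<comment> \<open>The sequence is constant once \<open>t\<close> reaches \<open>tm\<close>,
      where the coset condition becomes a condition on classes modulo \<pp>^t.\<close>
    have "convergent (density_seq v (gram b e) tm s) \<and> lim (density_seq v (gram b e) tm s) =
        real (residue_norm v) powr (- real_of_int tm + real_of_ereal (min (ereal (real_of_int tm))
          (min (ordp v ((s $ 1)\<^sup>2 + \<alpha> * (s $ 2)\<^sup>2)) (ordp v (s $ 1)))))"
      unfolding assms(4)
      by (rule convergent_lim_eventually_const[of "nat tm"])
        (rule density_seq_pos[OF two \<alpha> s su tm], simp)
    then show "convergent (density_seq v (gram b e) tm s)"
      "beta_plus v (gram b e) tm s = real (residue_norm v) powr
        (- real_of_int tm + real_of_ereal (min (ereal (real_of_int tm))
          (min (ordp v ((s $ 1)\<^sup>2 + \<alpha> * (s $ 2)\<^sup>2)) (ordp v (s $ 1)))))"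
      by (simp_all add: beta_plus_def)
  qed
qed

end
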